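(* Let $g\in\mathcal{C}(\overline{\mathbb{D}})$, $\gamma_0,\gamma\in\mathcal{C}(\mathbb{T})$ and $c\in\mathbb{C}$. Suppose that $w\in\mathcal{C}^{4}(\mathbb{D})\cap\mathcal{C}(\overline{\mathbb{D}})$ satisfies $$(\partial_z\partial_{\overline z})^2w=g \text{ in }\mathbb{D},\qquad w=\gamma_0\text{ on }\mathbb{T},\qquad \partial_\nu\partial_z\partial_{\overline z}w=\gamma\text{ on }\mathbb{T},$$ together with $$\frac{1}{2\pi i}\int_{\mathbb{T}}w_{\zeta\overline{\zeta}}(\zeta)\frac{d\zeta}{\zeta}=c\qquad\text{and}\qquad \frac{1}{2\pi}\int_0^{2\pi}\gamma(e^{it})\,dt=2\int_{\mathbb{D}}g(\zeta)\,dA(\zeta).$$ Then for every $z\in\mathbb{D}$, $$\|D_w(z)\|\le\frac{4}{\pi}\|\mathcal{P}_{\gamma_0}\|_\infty\frac{1}{1-|z|^2}+2|c|+\|\gamma\|_\infty N_3(|z|)+\|g\|_\infty N_4(|z|),$$ where $$N_3(t)=2\left(\frac{\pi^2}{3}+1\right)^{1/2}+t\left(\frac23\pi^2-2\right)^{1/2}+(1-t^2)\left(\frac{\pi^2}{6}-1\right)^{1/2}+\left(\frac{\pi^2}{3}-\frac12\right)^{1/2},$$ $$N_4(t)=2(\log 4+1)+t\left(\frac23\pi^2-2\right)^{1/2}+\frac23(1-t^2)\left(\frac{\pi^2}{6}-1\right)^{1/2}+\frac23\left(\frac{\pi^2}{3}-\frac12\right)^{1/2}.$$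
   Context: $\mathbb{D}=\{z\in\mathbb{C}:|z|<1\}$, $\mathbb{T}=\partial\mathbb{D}$, $\overline{\mathbb{D}}=\mathbb{D}\cup\mathbb{T}$. Functions are complex-valued; $\mathcal{C}(\cdot)$ denotes continuous functions. $\partial_z=\frac12(\partial_x-i\partial_y)$, $\partial_{\overline z}=\frac12(\partial_x+i\partial_y)$, $w_z=\partial_zw$, $w_{\overline z}=\partial_{\overline z}w$, $w_{\zeta\overline\zeta}=\partial_\zeta\partial_{\overline\zeta}w$, and $\partial_\nu$ denotes differentiation in the outward normal direction on $\mathbb{T}$. $dA(\zeta)=\frac1\pi\,dx\,dy$ is the normalized area measure on $\mathbb{D}$. $D_w(z)$ is the real $2\times2$ Jacobian matrix of $w$ at $z$ and $\|D_w(z)\|=\sup\{|D_w(z)\varsigma|:|\varsigma|=1\}=|w_z(z)|+|w_{\overline z}(z)|$. The Poisson integral is $$\mathcal{P}_{\gamma_0}(z)=\frac{1}{2\pi}\int_0^{2\pi}\frac{1-|z|^2}{|1-ze^{-it}|^2}\gamma_0(e^{it})\,dt,\quad z\in\mathbb{D}.$$ Norms: $\|\mathcal{P}_{\gamma_0}\|_\infty=\sup_{z\in\mathbb{D}}|\mathcal{P}_{\gamma_0}(z)|$, $\|\gamma\|_\infty=\sup_{z\in\mathbb{T}}|\gamma(z)|$, $\|g\|_\infty=\sup_{z\in\mathbb{D}}|g(z)|$. *)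

theory Defs
  imports "HOL-Complex_Analysis.Complex_Analysis"
begin

abbreviation unit_disc :: "complex set" ("\<bbbD>")
  where "\<bbbD> \<equiv> ball 0 1"

abbreviation unit_circle :: "complex set" ("\<bbbT>")
  where "\<bbbT> \<equiv> sphere 0 1"

definition partial_x :: "(complex \<Rightarrow> complex) \<Rightarrow> complex \<Rightarrow> complex"
  where "partial_x f z = frechet_derivative f (at z) 1"

definition partial_y :: "(complex \<Rightarrow> complex) \<Rightarrow> complex \<Rightarrow> complex"
  where "partial_y f z = frechet_derivative f (at z) \<i>"

text \<open>Real differentiability of class $C^k$; meant for open \<open>S\<close>, since the
  derivatives are taken \<open>at z\<close> and not within \<open>S\<close>.\<close>

fun C_k_on :: "nat \<Rightarrow> (complex \<Rightarrow> complex) \<Rightarrow> complex set \<Rightarrow> bool"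
  where
    "C_k_on 0 f S \<longleftrightarrow> continuous_on S f"
  | "C_k_on (Suc k) f S \<longleftrightarrow>
      (\<forall>z\<in>S. f differentiable (at z)) \<and> C_k_on k (partial_x f) S \<and> C_k_on k (partial_y f) S"

definition d_z :: "(complex \<Rightarrow> complex) \<Rightarrow> complex \<Rightarrow> complex"
  where "d_z f z = (partial_x f z - \<i> * partial_y f z) / 2"

definition d_zbar :: "(complex \<Rightarrow> complex) \<Rightarrow> complex \<Rightarrow> complex"
  where "d_zbar f z = (partial_x f z + \<i> * partial_y f z) / 2"

definition d_z_zbar :: "(complex \<Rightarrow> complex) \<Rightarrow> complex \<Rightarrow> complex"
  where "d_z_zbar f = d_z (d_zbar f)"

definition jacobian_norm :: "(complex \<Rightarrow> complex) \<Rightarrow> complex \<Rightarrow> real"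
  where "jacobian_norm w z = (SUP \<xi>\<in>sphere 0 1. norm (frechet_derivative w (at z) \<xi>))"

text \<open>The outward normal at \<open>\<zeta>\<close> on the unit circle is \<open>\<zeta>\<close> itself. The derivative is
  one-sided: only values of \<open>u\<close> on the radius from \<open>0\<close> to \<open>\<zeta>\<close> enter.\<close>

definition has_outward_normal_derivative ::
    "(complex \<Rightarrow> complex) \<Rightarrow> complex \<Rightarrow> complex \<Rightarrow> bool"
  where "has_outward_normal_derivative u d \<zeta> \<longleftrightarrow>
    ((\<lambda>r::real. u (of_real r * \<zeta>)) has_vector_derivative d) (at 1 within {0..1})"

definition poisson_integral :: "(complex \<Rightarrow> complex) \<Rightarrow> complex \<Rightarrow> complex"
  where "poisson_integral \<gamma>\<^sub>0 z =
    1 / (2 * of_real pi) *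
      integral {0..2 * pi}
        (\<lambda>t. of_real ((1 - (norm z)\<^sup>2) / (norm (1 - z * cis (- t)))\<^sup>2) * \<gamma>\<^sub>0 (cis t))"

definition disc_integral :: "(complex \<Rightarrow> complex) \<Rightarrow> complex"
  \<comment> \<open>with respect to the normalized area measure $dA = \frac{1}{\pi}\,dx\,dy$\<close>
  where "disc_integral g = 1 / of_real pi * (LINT \<zeta>:\<bbbD>|lborel. g \<zeta>)"

definition sup_norm_on :: "complex set \<Rightarrow> (complex \<Rightarrow> complex) \<Rightarrow> real"
  where "sup_norm_on S f = (SUP z\<in>S. norm (f z))"

definition N3 :: "real \<Rightarrow> real"
  where "N3 t = 2 * sqrt (pi\<^sup>2 / 3 + 1) + t * sqrt (2 / 3 * pi\<^sup>2 - 2)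
    + (1 - t\<^sup>2) * sqrt (pi\<^sup>2 / 6 - 1) + sqrt (pi\<^sup>2 / 3 - 1 / 2)"

definition N4 :: "real \<Rightarrow> real"
  where "N4 t = 2 * (ln 4 + 1) + t * sqrt (2 / 3 * pi\<^sup>2 - 2)
    + 2 / 3 * (1 - t\<^sup>2) * sqrt (pi\<^sup>2 / 6 - 1) + 2 / 3 * sqrt (pi\<^sup>2 / 3 - 1 / 2)"

text \<open>For \<open>w\<close> of class $C^4$ in the open disc, \<open>d_z_zbar w\<close> has no values on the circle of its
  own. Boundary conditions on it refer to its continuous extension \<open>u\<close> to the closed disc, which
  is unique if it exists.\<close>

definition continuous_extension_to_closed_disc ::
    "(complex \<Rightarrow> complex) \<Rightarrow> (complex \<Rightarrow> complex) \<Rightarrow> bool"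
  where "continuous_extension_to_closed_disc f u \<longleftrightarrow>
    continuous_on (closure \<bbbD>) u \<and> (\<forall>z\<in>\<bbbD>. u z = f z)"

end

theory Submission
  imports Defs
begin

text \<open>
  Everything rests on the maximum principle, used with reflections. Let $u = w_{z\bar z}$, so that
  $u_{z\bar z} = g$, and let $z^*$ denote the mirror image of $z$ in a line $\ell$.

  If $v$ vanishes on the circle and $|v_{z\bar z}| \le M$, then $|v| \le M(1-|z|^2)$. On the smaller
  cap cut off by $\ell$ the function $v(z) - v(z^*)$ vanishes on $\ell$, and on the arc it is at
  most $M(1-|z^*|^2)$, a multiple of the distance to $\ell$; comparison with a quadratic barrier
  bounds the derivative of $v$ across $\ell$ by $2M$.

  If $\ell$ is a diameter, $u(z) - u(z^*)$ vanishes on $\ell$ and has normal derivative at most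
  $2\|\gamma\|_\infty$ on the half circle. Comparison with an explicit barrier bounds it, and
  averaging over all diameters bounds $u$ minus its mean over the circle through $z$, hence
  $|u - c| \le 2(1 + 2/\pi)\|\gamma\|_\infty + 3\|g\|_\infty$. Only a one-sided derivative at
  single boundary points enters, so no representation formula for $u$ is needed.

  The theorem follows by applying the first bound to
  $v = w - \mathcal{P}_{\gamma_0} - c(|z|^2 - 1)$, for which $v_{z\bar z} = u - c$. The gradient of
  the bounded harmonic function $\mathcal{P}_{\gamma_0}$ is estimated by the Schwarz-Pick lemma.
\<close>

section \<open>Wirtinger derivatives and the symmetry of second derivatives\<close>

text \<open>Two points on a circle about 0 are mirror images in a diameter; this is why estimates
  across diameters control $u$ minus its mean over the circle $|z| = r$. Passing from that mean to
  the mean over the unit circle, which is $c$, costs another $G(1-r^2)$, where $G$ bounds $|g|$. The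
  constants leave little room. The gradient of $v$ is at most twice the bound for $|u - c|$, so the
  theorem needs $4(1+2/pi) \<le> N_3(t)$ and $6 \<le> N_4(t)$ on all of $[0,1]$; at $t = 0$ the
  first inequality has a margin below $0.1$. Hence a barrier bounded by $1 + Re z$ (whose average
  over the diameters is at most $1 + 2/pi$), and a cubic rather than a cruder barrier for $g$. Every
  comparison function is perturbed by some $e > 0$. A strictly positive Laplacian excludes interior
  maxima by the second derivative test, and a strictly negative radial derivative excludes maxima on
  the open half circle; this replaces the strong maximum principle and the Hopf lemma.\<close>

lemma second_difference:
  fixes f :: "'a::real_normed_vector \<Rightarrow> 'b::real_normed_vector"
  assumes r: "r > 0" and f': "\<And>x. x \<in> ball z r \<Longrightarrow> (f has_derivative f' x) (at x)"
    and L: "((\<lambda>x. f' x a) has_derivative L) (at z)" and \<epsilon>: "\<epsilon> > 0"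
  shows "\<exists>\<delta>>0. \<forall>h. 0 < h \<and> h < \<delta> \<longrightarrow>
    norm (f (z + h *\<^sub>R a + h *\<^sub>R b) - f (z + h *\<^sub>R a) - f (z + h *\<^sub>R b) + f z - (h * h) *\<^sub>R L b)
      \<le> \<epsilon> * (h * h)"
proof -
  \<comment> \<open>Two error terms arise below, each at most
    \<open>e * (h * (norm a + norm b))\<close>. The summand 1 keeps \<open>N\<close> positive when
    \<open>a\<close> and \<open>b\<close> vanish.\<close>
  define N where "N = 2 * (norm a + norm b) + 1"
  have N: "N > 0" by (auto simp: N_def intro!: add_nonneg_pos)
  define e where "e = \<epsilon> / N"
  have e: "e > 0" using N \<epsilon> by (simp add: e_def)
  have L_lin: "bounded_linear L" using L has_derivative_bounded_linear by blast
  interpret L: bounded_linear L by fact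
  from L e obtain d where d: "d > 0"
    "\<And>y. norm (y - z) < d \<Longrightarrow> norm (f' y a - f' z a - L (y - z)) \<le> e * norm (y - z)"
    unfolding has_derivative_at_alt by blast
  define \<delta> where "\<delta> = min d r / N"
  have "\<delta> > 0" using d r N by (simp add: \<delta>_def)
  moreover have "norm (f (z + h *\<^sub>R a + h *\<^sub>R b) - f (z + h *\<^sub>R a) - f (z + h *\<^sub>R b) + f z
      - (h * h) *\<^sub>R L b) \<le> \<epsilon> * (h * h)" if h: "0 < h" "h < \<delta>" for h
  proof -
    have hN: "h * N < min d r" using h N by (simp add: \<delta>_def field_simps)
    \<comment> \<open>The increment of \<open>g\<close> over \<open>{0..h}\<close> is the second
      difference minus its expected value. Its derivative compares \<open>f' x a\<close> at two
      points near \<open>z\<close>, so differentiability at the single point \<open>z\<close> makes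
      it at most \<open>\<epsilon> * h\<close>; the mean value inequality supplies the second factor
      \<open>h\<close>.\<close>
    define g where "g = (\<lambda>s. f (z + h *\<^sub>R b + s *\<^sub>R a) - f (z + s *\<^sub>R a) - s *\<^sub>R (h *\<^sub>R L b))"
    have n1: "norm (s *\<^sub>R a) \<le> h * norm a" if "s \<in> {0..h}" for s
      using that by (auto intro: mult_right_mono)
    have n2: "norm (h *\<^sub>R b + s *\<^sub>R a) \<le> h * (norm a + norm b)" if "s \<in> {0..h}" for s
      using norm_triangle_ineq[of "h *\<^sub>R b" "s *\<^sub>R a"] n1[OF that] h by (auto simp: algebra_simps)
    have "h * (2 * (norm a + norm b) + 1) < min d r" using hN by (simp add: N_def)
    moreover have "h * (norm a + norm b) \<le> h * (2 * (norm a + norm b) + 1)"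
      using h by (intro mult_left_mono) (auto simp: add_nonneg_nonneg)
    ultimately have hb2: "h * (norm a + norm b) < min d r" by linarith
    have hb1: "h * norm a \<le> h * (norm a + norm b)" using h by (intro mult_left_mono) auto
    note hb = hb1 hb2
    have der: "(g has_derivative (\<lambda>t. t *\<^sub>R (f' (z + h *\<^sub>R b + s *\<^sub>R a) a - f' (z + s *\<^sub>R a) a - h *\<^sub>R L b)))
        (at s within {0..h})" if s: "s \<in> {0..h}" for s
    proof -
      have "norm (s *\<^sub>R a) < r" "norm (h *\<^sub>R b + s *\<^sub>R a) < r"
        using le_less_trans[OF n1[OF s] le_less_trans[OF hb1 hb2]] le_less_trans[OF n2[OF s] hb2] by linarith+
      moreover have "dist z (z + x) = norm x" for x :: 'a by (simp add: dist_norm)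
      ultimately have m1: "z + h *\<^sub>R b + s *\<^sub>R a \<in> ball z r" and m2: "z + s *\<^sub>R a \<in> ball z r"
        by (simp_all only: mem_ball add.assoc)
      have lin1: "bounded_linear (f' (z + h *\<^sub>R b + s *\<^sub>R a))" "bounded_linear (f' (z + s *\<^sub>R a))"
        using f'[OF m1] f'[OF m2] has_derivative_bounded_linear by blast+
      have "((\<lambda>s. z + h *\<^sub>R b + s *\<^sub>R a) has_derivative (\<lambda>t. t *\<^sub>R a)) (at s within {0..h})"
        by (auto intro!: derivative_eq_intros)
      then have c1: "((\<lambda>s. f (z + h *\<^sub>R b + s *\<^sub>R a)) has_derivative (\<lambda>t. f' (z + h *\<^sub>R b + s *\<^sub>R a) (t *\<^sub>R a))) (at s within {0..h})"
        using f'[OF m1] by (rule has_derivative_compose)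
      have "((\<lambda>s. z + s *\<^sub>R a) has_derivative (\<lambda>t. t *\<^sub>R a)) (at s within {0..h})"
        by (auto intro!: derivative_eq_intros)
      then have c2: "((\<lambda>s. f (z + s *\<^sub>R a)) has_derivative (\<lambda>t. f' (z + s *\<^sub>R a) (t *\<^sub>R a))) (at s within {0..h})"
        using f'[OF m2] by (rule has_derivative_compose)
      have c3: "((\<lambda>s. s *\<^sub>R (h *\<^sub>R L b)) has_derivative (\<lambda>t. t *\<^sub>R (h *\<^sub>R L b))) (at s within {0..h})"
        by (rule bounded_linear.has_derivative[OF bounded_linear_scaleR_left has_derivative_ident])
      have eq: "(\<lambda>t. f' (z + h *\<^sub>R b + s *\<^sub>R a) (t *\<^sub>R a) - f' (z + s *\<^sub>R a) (t *\<^sub>R a) - t *\<^sub>R (h *\<^sub>R L b)) =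
         (\<lambda>t. t *\<^sub>R (f' (z + h *\<^sub>R b + s *\<^sub>R a) a - f' (z + s *\<^sub>R a) a - h *\<^sub>R L b))"
        by (simp only: linear_cmul[OF bounded_linear.linear[OF lin1(1)]]
            linear_cmul[OF bounded_linear.linear[OF lin1(2)]] scaleR_diff_right)
      show ?thesis unfolding g_def
        using has_derivative_diff[OF has_derivative_diff[OF c1 c2] c3] unfolding eq .
    qed
    have bd: "norm (f' (z + h *\<^sub>R b + s *\<^sub>R a) a - f' (z + s *\<^sub>R a) a - h *\<^sub>R L b) \<le> \<epsilon> * h"
      if s: "s \<in> {0..h}" for s
    proof -
      have 1: "norm (f' (z + h *\<^sub>R b + s *\<^sub>R a) a - f' z a - L (h *\<^sub>R b + s *\<^sub>R a)) \<le> e * norm (h *\<^sub>R b + s *\<^sub>R a)"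
        using d(2)[of "z + h *\<^sub>R b + s *\<^sub>R a"] n2[OF s] hb by (simp add: add.assoc)
      have 2: "norm (f' (z + s *\<^sub>R a) a - f' z a - L (s *\<^sub>R a)) \<le> e * norm (s *\<^sub>R a)"
        using d(2)[of "z + s *\<^sub>R a"] n1[OF s] hb by simp
      have eq: "f' (z + h *\<^sub>R b + s *\<^sub>R a) a - f' (z + s *\<^sub>R a) a - h *\<^sub>R L b =
        (f' (z + h *\<^sub>R b + s *\<^sub>R a) a - f' z a - L (h *\<^sub>R b + s *\<^sub>R a)) - (f' (z + s *\<^sub>R a) a - f' z a - L (s *\<^sub>R a))"
        by (simp add: L.add L.scaleR)
      have "norm (f' (z + h *\<^sub>R b + s *\<^sub>R a) a - f' (z + s *\<^sub>R a) a - h *\<^sub>R L b)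
          \<le> e * norm (h *\<^sub>R b + s *\<^sub>R a) + e * norm (s *\<^sub>R a)"
        unfolding eq using norm_triangle_ineq4 1 2 by (smt (verit))
      also have "\<dots> \<le> e * (h * (norm a + norm b)) + e * (h * (norm a + norm b))"
        using n1[OF s] n2[OF s] hb e by (intro add_mono mult_left_mono) auto
      also have "\<dots> \<le> e * (h * N)" using e h by (simp add: N_def algebra_simps)
      also have "\<dots> = \<epsilon> * h" using N by (simp add: e_def)
      finally show ?thesis .
    qed
    have "norm (g h - g 0) \<le> (\<epsilon> * h) * norm (h - 0)"
    proof (rule differentiable_bound[where S="{0..h}"])
      fix s assume "s \<in> {0..h}"
      show "onorm (\<lambda>t. t *\<^sub>R (f' (z + h *\<^sub>R b + s *\<^sub>R a) a - f' (z + s *\<^sub>R a) a - h *\<^sub>R L b)) \<le> \<epsilon> * h"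
        using bd[OF \<open>s \<in> _\<close>] h \<epsilon>
        by (intro onorm_bound) (simp_all add: mult.commute[of "\<bar>_\<bar>"] mult_right_mono)
    qed (use der h in auto)
    moreover have "g h - g 0 = f (z + h *\<^sub>R a + h *\<^sub>R b) - f (z + h *\<^sub>R a) - f (z + h *\<^sub>R b) + f z - (h * h) *\<^sub>R L b"
      by (simp add: g_def algebra_simps)
    ultimately show ?thesis using h by (simp add: mult.assoc)
  qed
  ultimately show ?thesis by blast
qed

text \<open>The second difference is unchanged when \<open>a\<close> and \<open>b\<close> are
  swapped, and divided by $h^2$ it tends both to \<open>La b\<close> and to \<open>Lb a\<close>.
  Since \<open>C_k_on\<close> merely iterates \<open>partial_x\<close> and \<open>partial_y\<close>,
  the equality of mixed derivatives has to be derived.\<close>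

lemma second_derivative_symmetric:
  fixes f :: "'a::real_normed_vector \<Rightarrow> 'b::real_normed_vector"
  assumes r: "r > 0" and f': "\<And>x. x \<in> ball z r \<Longrightarrow> (f has_derivative f' x) (at x)"
    and La: "((\<lambda>x. f' x a) has_derivative La) (at z)"
    and Lb: "((\<lambda>x. f' x b) has_derivative Lb) (at z)"
  shows "La b = Lb a"
proof -
  have "norm (La b - Lb a) \<le> 0 + e" if e: "e > 0" for e
  proof -
    from second_difference[OF r f' La half_gt_zero[OF e], of b] obtain d1 where d1: "d1 > 0"
      "\<And>h. 0 < h \<and> h < d1 \<Longrightarrow> norm (f (z + h *\<^sub>R a + h *\<^sub>R b) - f (z + h *\<^sub>R a) - f (z + h *\<^sub>R b) + f z
      - (h * h) *\<^sub>R La b) \<le> e / 2 * (h * h)" by blast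
    from second_difference[OF r f' Lb half_gt_zero[OF e], of a] obtain d2 where d2: "d2 > 0"
      "\<And>h. 0 < h \<and> h < d2 \<Longrightarrow> norm (f (z + h *\<^sub>R b + h *\<^sub>R a) - f (z + h *\<^sub>R b) - f (z + h *\<^sub>R a) + f z
      - (h * h) *\<^sub>R Lb a) \<le> e / 2 * (h * h)" by blast
    define h where "h = min d1 d2 / 2"
    have h: "h > 0" "h < d1" "h < d2" using d1(1) d2(1) by (auto simp: h_def)
    define X where "X = f (z + h *\<^sub>R a + h *\<^sub>R b) - f (z + h *\<^sub>R a) - f (z + h *\<^sub>R b) + f z"
    have 1: "norm (X - (h * h) *\<^sub>R La b) \<le> e / 2 * (h * h)" using d1(2) h by (simp add: X_def)
    have 2: "norm (X - (h * h) *\<^sub>R Lb a) \<le> e / 2 * (h * h)" using d2(2)[of h] h by (simp add: X_def algebra_simps)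
    have "norm ((h * h) *\<^sub>R (La b - Lb a)) = norm ((X - (h * h) *\<^sub>R Lb a) - (X - (h * h) *\<^sub>R La b))"
      by (simp add: algebra_simps)
    also have "\<dots> \<le> e * (h * h)" using norm_triangle_ineq4 1 2 by (smt (verit) field_sum_of_halves distrib_right)
    finally have "(h * h) * norm (La b - Lb a) \<le> (h * h) * e" by (simp add: mult.commute)
    then show ?thesis using h by simp
  qed
  then have "norm (La b - Lb a) \<le> 0" by (rule field_le_epsilon)
  then show ?thesis by simp
qed

text \<open>\<open>A\<close> and \<open>B\<close> are the two Wirtinger derivatives of \<open>f\<close>. The symmetry
  $f_{z\bar z} = f_{\bar z z}$ is built in: the same \<open>L\<close> occurs in the derivatives of both.\<close>

definition has_wirtinger_laplacian :: "(complex \<Rightarrow> complex) \<Rightarrow> (complex \<Rightarrow> complex) \<Rightarrow> complex set \<Rightarrow> bool"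
  where "has_wirtinger_laplacian f L S \<longleftrightarrow>
    (\<exists>A B A1 B2. \<forall>z\<in>S. (f has_derivative (\<lambda>h. A z * h + B z * cnj h)) (at z) \<and>
      (A has_derivative (\<lambda>h. A1 z * h + L z * cnj h)) (at z) \<and>
      (B has_derivative (\<lambda>h. L z * h + B2 z * cnj h)) (at z))"

lemma has_wirtinger_laplacianI:
  assumes "\<And>z. z \<in> S \<Longrightarrow> (f has_derivative (\<lambda>h. A z * h + B z * cnj h)) (at z)"
    and "\<And>z. z \<in> S \<Longrightarrow> (A has_derivative (\<lambda>h. A1 z * h + L z * cnj h)) (at z)"
    and "\<And>z. z \<in> S \<Longrightarrow> (B has_derivative (\<lambda>h. L z * h + B2 z * cnj h)) (at z)"
  shows "has_wirtinger_laplacian f L S"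
  unfolding has_wirtinger_laplacian_def
  by (rule exI[of _ A], rule exI[of _ B], rule exI[of _ A1], rule exI[of _ B2]) (simp add: assms)

lemma has_wirtinger_laplacianE:
  assumes "has_wirtinger_laplacian f L S"
  obtains A B A1 B2 where "\<And>z. z \<in> S \<Longrightarrow> (f has_derivative (\<lambda>h. A z * h + B z * cnj h)) (at z)"
    and "\<And>z. z \<in> S \<Longrightarrow> (A has_derivative (\<lambda>h. A1 z * h + L z * cnj h)) (at z)"
    and "\<And>z. z \<in> S \<Longrightarrow> (B has_derivative (\<lambda>h. L z * h + B2 z * cnj h)) (at z)"
proof -
  from assms obtain A B A1 B2 where "\<forall>z\<in>S. (f has_derivative (\<lambda>h. A z * h + B z * cnj h)) (at z) \<and>
      (A has_derivative (\<lambda>h. A1 z * h + L z * cnj h)) (at z) \<and>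
      (B has_derivative (\<lambda>h. L z * h + B2 z * cnj h)) (at z)"
    unfolding has_wirtinger_laplacian_def by (elim exE)
  then show ?thesis by (intro that[of A B A1 B2]) simp_all
qed

lemma frechet_derivative_wirtinger:
  assumes "f differentiable (at z)"
  shows "(f has_derivative (\<lambda>h. d_z f z * h + d_zbar f z * cnj h)) (at z)"
proof -
  have D: "(f has_derivative frechet_derivative f (at z)) (at z)"
    using assms by (simp add: frechet_derivative_works)
  have lin: "linear (frechet_derivative f (at z))"
    using D has_derivative_linear by blast
  have "frechet_derivative f (at z) h = d_z f z * h + d_zbar f z * cnj h" for h
  proof -
    have h: "h = Re h *\<^sub>R 1 + Im h *\<^sub>R \<i>" by (simp add: complex_eq_iff)
    have "frechet_derivative f (at z) h = Re h *\<^sub>R partial_x f z + Im h *\<^sub>R partial_y f z"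
      by (subst h) (simp only: linear_add[OF lin] linear_cmul[OF lin] partial_x_def partial_y_def)
    also have "\<dots> = d_z f z * h + d_zbar f z * cnj h"
      by (simp add: d_z_def d_zbar_def complex_eq_iff field_simps)
    finally show ?thesis .
  qed
  then show ?thesis using D by (metis (no_types, lifting) ext)
qed

section \<open>Calculus of the classes $C^k$\<close>

lemma C_k_on_cong:
  assumes "open S" "C_k_on k f S" "\<And>z. z \<in> S \<Longrightarrow> f z = g z"
  shows "C_k_on k g S"
  using assms(2,3)
proof (induction k arbitrary: f g)
  case 0
  then show ?case by (simp cong: continuous_on_cong)
next
  case (Suc k)
  have D: "(g has_derivative frechet_derivative f (at z)) (at z)" if z: "z \<in> S" for z
  proof (rule has_derivative_transform_within_open[OF _ \<open>open S\<close> z])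
    show "(f has_derivative frechet_derivative f (at z)) (at z)"
      using Suc.prems(1) z frechet_derivative_works by auto
  qed (use Suc.prems(2) in auto)
  then have "frechet_derivative f (at z) = frechet_derivative g (at z)" if "z \<in> S" for z
    using that frechet_derivative_at by blast
  then have "partial_x f z = partial_x g z" "partial_y f z = partial_y g z" if "z \<in> S" for z
    using that by (simp_all add: partial_x_def partial_y_def)
  moreover have "\<forall>z\<in>S. g differentiable (at z)" using D unfolding differentiable_def by blast
  ultimately show ?case using Suc by auto
qed

lemma C_k_on_lincomb:
  assumes "open S" "C_k_on k f S" "C_k_on k g S"
  shows "C_k_on k (\<lambda>z. a * f z + b * g z) S"
  using assms(2,3)
proof (induction k arbitrary: f g)
  case 0
  then show ?case by (auto intro!: continuous_intros)
next
  case (Suc k)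
  have D: "((\<lambda>z. a * f z + b * g z) has_derivative
      (\<lambda>h. a * frechet_derivative f (at z) h + b * frechet_derivative g (at z) h)) (at z)" if "z \<in> S" for z
    using Suc.prems that frechet_derivative_works
    by (intro has_derivative_add has_derivative_mult_right) auto
  have eq: "frechet_derivative (\<lambda>z. a * f z + b * g z) (at z) h =
     a * frechet_derivative f (at z) h + b * frechet_derivative g (at z) h" if "z \<in> S" for z h
    using frechet_derivative_at[OF D[OF that]] by metis
  have "C_k_on k (\<lambda>z. a * partial_x f z + b * partial_x g z) S"
    "C_k_on k (\<lambda>z. a * partial_y f z + b * partial_y g z) S"
    using Suc by auto
  from this[THEN C_k_on_cong[OF \<open>open S\<close>]]
  have "C_k_on k (partial_x (\<lambda>z. a * f z + b * g z)) S" "C_k_on k (partial_y (\<lambda>z. a * f z + b * g z)) S"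
    by (simp_all add: partial_x_def partial_y_def eq)
  moreover have "\<forall>z\<in>S. (\<lambda>z. a * f z + b * g z) differentiable (at z)"
    using D unfolding differentiable_def by blast
  ultimately show ?case by simp
qed

lemma C_k_on_SucD: "C_k_on (Suc k) f S \<Longrightarrow> C_k_on k f S"
proof (induction k arbitrary: f)
  case 0
  then show ?case
    by (auto simp: continuous_on_eq_continuous_within differentiable_imp_continuous_within
       intro: continuous_at_imp_continuous_at_within)
next
  case (Suc k)
  then show ?case by (metis C_k_on.simps(2))
qed

lemma C_k_on_wirtinger:
  assumes "open S" "C_k_on (Suc k) f S"
  shows "C_k_on k (d_z f) S" "C_k_on k (d_zbar f) S"
proof -
  have "C_k_on k (\<lambda>z. (1/2) * partial_x f z + (-\<i>/2) * partial_y f z) S"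
    "C_k_on k (\<lambda>z. (1/2) * partial_x f z + (\<i>/2) * partial_y f z) S"
    using assms by (simp_all only: C_k_on.simps C_k_on_lincomb)
  from this[THEN C_k_on_cong[OF \<open>open S\<close>]] show "C_k_on k (d_z f) S" "C_k_on k (d_zbar f) S"
    by (simp_all add: d_z_def d_zbar_def field_simps)
qed

lemma C2_has_wirtinger_laplacian:
  assumes S: "open S" and f: "C_k_on 2 f S"
  shows "has_wirtinger_laplacian f (d_z_zbar f) S"
proof -
  have f2: "C_k_on (Suc (Suc 0)) f S" using f by (simp add: numeral_2_eq_2)
  have A: "C_k_on (Suc 0) (d_z f) S" and B: "C_k_on (Suc 0) (d_zbar f) S"
    using C_k_on_wirtinger[OF S f2] by auto
  have D: "(f has_derivative (\<lambda>h. d_z f z * h + d_zbar f z * cnj h)) (at z)"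
    "(d_z f has_derivative (\<lambda>h. d_z (d_z f) z * h + d_zbar (d_z f) z * cnj h)) (at z)"
    "(d_zbar f has_derivative (\<lambda>h. d_z (d_zbar f) z * h + d_zbar (d_zbar f) z * cnj h)) (at z)"
    if "z \<in> S" for z using that f2 A B by (auto intro!: frechet_derivative_wirtinger)
  have "d_zbar (d_z f) z = d_z (d_zbar f) z" if z: "z \<in> S" for z
  proof -
    obtain r where r: "r > 0" "ball z r \<subseteq> S" using S z openE by blast
    let ?f' = "\<lambda>z h. d_z f z * h + d_zbar f z * cnj h"
    let ?L = "\<lambda>a h. (d_z (d_z f) z * h + d_zbar (d_z f) z * cnj h) * a +
       (d_z (d_zbar f) z * h + d_zbar (d_zbar f) z * cnj h) * cnj a"
    \<comment> \<open>In the mixed directions 1 and i the pure second derivatives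
      \<open>d_z (d_z f)\<close> and \<open>d_zbar (d_zbar f)\<close> contribute the same on both
      sides and cancel, leaving the difference of the two mixed ones.\<close>
    have "?L 1 \<i> = ?L \<i> 1"
      by (rule second_derivative_symmetric[of r z f ?f' 1 "?L 1" \<i> "?L \<i>"])
       (use r D z in \<open>auto intro!: derivative_eq_intros D\<close>)
    then have "2 * \<i> * (d_z (d_zbar f) z - d_zbar (d_z f) z) = 0"
      by (simp add: algebra_simps)
    then show ?thesis by simp
  qed
  then show ?thesis using D unfolding d_z_zbar_def
    by (intro has_wirtinger_laplacianI[where A="d_z f" and B="d_zbar f" and ?A1.0="d_z (d_z f)"
      and ?B2.0="d_zbar (d_zbar f)"]) auto
qed

section \<open>The maximum principle\<close>

lemma has_wirtinger_laplacian_subset: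
  "has_wirtinger_laplacian f L S \<Longrightarrow> T \<subseteq> S \<Longrightarrow> has_wirtinger_laplacian f L T"
  unfolding has_wirtinger_laplacian_def by (elim exE) (intro exI ballI, drule bspec, erule subsetD)

lemma has_wirtinger_laplacian_cong:
  assumes "has_wirtinger_laplacian f L S" "open S"
    and "\<And>z. z \<in> S \<Longrightarrow> f z = g z" "\<And>z. z \<in> S \<Longrightarrow> L z = M z"
  shows "has_wirtinger_laplacian g M S"
proof -
  from assms(1) obtain A B A1 B2 where *:
    "\<And>z. z \<in> S \<Longrightarrow> (f has_derivative (\<lambda>h. A z * h + B z * cnj h)) (at z)"
    "\<And>z. z \<in> S \<Longrightarrow> (A has_derivative (\<lambda>h. A1 z * h + L z * cnj h)) (at z)"
    "\<And>z. z \<in> S \<Longrightarrow> (B has_derivative (\<lambda>h. L z * h + B2 z * cnj h)) (at z)"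
    by (rule has_wirtinger_laplacianE) (rule that)
  show ?thesis
    using has_derivative_transform_within_open[OF *(1) assms(2)] *(2,3) assms(3,4)
    by (intro has_wirtinger_laplacianI[of S g A B A1 M B2]) simp_all
qed

text \<open>Later functions carry factors such as \<open>1 *\<close> and summands such as
  \<open>0 * 0\<close>: they are written as nested combinations \<open>a * f z + b * g z\<close> so
  that this rule matches them and builds the Laplacian.\<close>

lemma has_wirtinger_laplacian_lincomb:
  assumes "has_wirtinger_laplacian f L S" "has_wirtinger_laplacian g M S"
  shows "has_wirtinger_laplacian (\<lambda>z. a * f z + b * g z) (\<lambda>z. a * L z + b * M z) S"
proof -
  from assms(1) obtain A B A1 B2 where *:
    "\<And>z. z \<in> S \<Longrightarrow> (f has_derivative (\<lambda>h. A z * h + B z * cnj h)) (at z)"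
    "\<And>z. z \<in> S \<Longrightarrow> (A has_derivative (\<lambda>h. A1 z * h + L z * cnj h)) (at z)"
    "\<And>z. z \<in> S \<Longrightarrow> (B has_derivative (\<lambda>h. L z * h + B2 z * cnj h)) (at z)"
    by (rule has_wirtinger_laplacianE) (rule that)
  from assms(2) obtain A' B' A1' B2' where **:
    "\<And>z. z \<in> S \<Longrightarrow> (g has_derivative (\<lambda>h. A' z * h + B' z * cnj h)) (at z)"
    "\<And>z. z \<in> S \<Longrightarrow> (A' has_derivative (\<lambda>h. A1' z * h + M z * cnj h)) (at z)"
    "\<And>z. z \<in> S \<Longrightarrow> (B' has_derivative (\<lambda>h. M z * h + B2' z * cnj h)) (at z)"
    by (rule has_wirtinger_laplacianE) (rule that)
  have D: "((\<lambda>z. a * F z + b * G z) has_derivative (\<lambda>h. (a * c + b * c') * h + (a * d + b * d') * cnj h)) (at z)"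
    if "(F has_derivative (\<lambda>h. c * h + d * cnj h)) (at z)" "(G has_derivative (\<lambda>h. c' * h + d' * cnj h)) (at z)"
    for F G c d c' d' z
    by (rule has_derivative_eq_rhs[OF has_derivative_add[OF has_derivative_mult_right[OF that(1), of a]
         has_derivative_mult_right[OF that(2), of b]]]) (simp add: fun_eq_iff algebra_simps)
  show ?thesis
    by (rule has_wirtinger_laplacianI[OF D[OF *(1) **(1)] D[OF *(2) **(2)] D[OF *(3) **(3)]])
qed

text \<open>One Wirtinger derivative sees only \<open>p\<close>, the other only \<open>q\<close>.
  Harmonic functions, $|z|^2$ and all barriers below are combinations of such products.\<close>

lemma has_wirtinger_laplacian_holomorphic_times_cnj:
  assumes "open S" "p holomorphic_on S" "q holomorphic_on S"
  shows "has_wirtinger_laplacian (\<lambda>z. p z * cnj (q z)) (\<lambda>z. deriv p z * cnj (deriv q z)) S"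
proof -
  have D: "((\<lambda>z. P z * cnj (Q z)) has_derivative (\<lambda>h. (deriv P z * cnj (Q z)) * h + (P z * cnj (deriv Q z)) * cnj h)) (at z)"
    if "P holomorphic_on S" "Q holomorphic_on S" "z \<in> S" for P Q z
  proof -
    have "(P has_derivative (\<lambda>h. deriv P z * h)) (at z)" "(Q has_derivative (\<lambda>h. deriv Q z * h)) (at z)"
      using that assms(1) holomorphic_derivI has_field_derivative_def by blast+
    note has_derivative_mult[OF this(1) has_derivative_cnj[OF this(2)]]
    then show ?thesis by (rule has_derivative_eq_rhs) (simp add: fun_eq_iff algebra_simps)
  qed
  have hol: "deriv p holomorphic_on S" "deriv q holomorphic_on S"
    using assms by (auto intro: holomorphic_deriv)
  show ?thesis
    by (rule has_wirtinger_laplacianI[OF D[OF assms(2,3)] D[OF hol(1) assms(3)] D[OF assms(2) hol(2)]])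
qed

lemma has_wirtinger_laplacian_holomorphic:
  assumes "open S" "p holomorphic_on S"
  shows "has_wirtinger_laplacian p (\<lambda>_. 0) S"
  using has_wirtinger_laplacian_holomorphic_times_cnj[OF assms, of "\<lambda>_. 1"] by simp

lemma has_wirtinger_laplacian_cnj_holomorphic:
  assumes "open S" "q holomorphic_on S"
  shows "has_wirtinger_laplacian (\<lambda>z. cnj (q z)) (\<lambda>_. 0) S"
  using has_wirtinger_laplacian_holomorphic_times_cnj[OF assms(1) _ assms(2), of "\<lambda>_. 1"] by simp

lemma has_wirtinger_laplacian_norm_square:
  assumes "open S"
  shows "has_wirtinger_laplacian (\<lambda>z. z * cnj z) (\<lambda>_. 1) S"
  using has_wirtinger_laplacian_holomorphic_times_cnj[OF assms, of "\<lambda>z. z" "\<lambda>z. z"] by simp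

lemma has_wirtinger_laplacian_affine:
  assumes "has_wirtinger_laplacian f L S" "\<And>z. z \<in> T \<Longrightarrow> a * z + b \<in> S"
  shows "has_wirtinger_laplacian (\<lambda>z. f (a * z + b)) (\<lambda>z. a * cnj a * L (a * z + b)) T"
proof -
  from assms(1) obtain A B A1 B2 where *:
    "\<And>z. z \<in> S \<Longrightarrow> (f has_derivative (\<lambda>h. A z * h + B z * cnj h)) (at z)"
    "\<And>z. z \<in> S \<Longrightarrow> (A has_derivative (\<lambda>h. A1 z * h + L z * cnj h)) (at z)"
    "\<And>z. z \<in> S \<Longrightarrow> (B has_derivative (\<lambda>h. L z * h + B2 z * cnj h)) (at z)"
    by (rule has_wirtinger_laplacianE) (rule that)
  have D: "((\<lambda>z. k * F (a * z + b)) has_derivative (\<lambda>h. k * (c * (a * h) + d * cnj (a * h)))) (at z)"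
    if "(F has_derivative (\<lambda>h. c * h + d * cnj h)) (at (a * z + b))" for F c d z k
  proof -
    have "((\<lambda>z. a * z + b) has_derivative (\<lambda>h. a * h)) (at z)"
      by (auto intro!: derivative_eq_intros)
    from has_derivative_compose[OF this that] show ?thesis by (rule has_derivative_mult_right)
  qed
  show ?thesis
    using D[OF *(1)[OF assms(2)], of _ 1] D[OF *(2)[OF assms(2)], of _ a] D[OF *(3)[OF assms(2)], of _ "cnj a"]
    by (intro has_wirtinger_laplacianI[where A="\<lambda>z. a * A (a * z + b)" and B="\<lambda>z. cnj a * B (a * z + b)"
       and ?A1.0="\<lambda>z. a * a * A1 (a * z + b)" and ?B2.0="\<lambda>z. cnj a * cnj a * B2 (a * z + b)"])
      (simp_all add: algebra_simps)
qed

text \<open>For real \<open>b\<close> this is the reflection in the line $Re z = b/2$. Being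
  antiholomorphic, it interchanges the two Wirtinger derivatives, so the symmetry built into
  \<open>has_wirtinger_laplacian\<close> is what makes the result have the same form; the two signs
  cancel.\<close>

lemma has_wirtinger_laplacian_reflect:
  assumes "has_wirtinger_laplacian f L S" "\<And>z. z \<in> T \<Longrightarrow> b - cnj z \<in> S"
  shows "has_wirtinger_laplacian (\<lambda>z. f (b - cnj z)) (\<lambda>z. L (b - cnj z)) T"
proof -
  from assms(1) obtain A B A1 B2 where *:
    "\<And>z. z \<in> S \<Longrightarrow> (f has_derivative (\<lambda>h. A z * h + B z * cnj h)) (at z)"
    "\<And>z. z \<in> S \<Longrightarrow> (A has_derivative (\<lambda>h. A1 z * h + L z * cnj h)) (at z)"
    "\<And>z. z \<in> S \<Longrightarrow> (B has_derivative (\<lambda>h. L z * h + B2 z * cnj h)) (at z)"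
    by (rule has_wirtinger_laplacianE) (rule that)
  have D: "((\<lambda>z. k * F (b - cnj z)) has_derivative (\<lambda>h. k * (c * (- cnj h) + d * (- h)))) (at z)"
    if "(F has_derivative (\<lambda>h. c * h + d * cnj h)) (at (b - cnj z))" for F c d z k
  proof -
    have "((\<lambda>z. b - cnj z) has_derivative (\<lambda>h. - cnj h)) (at z)"
      by (auto intro!: derivative_eq_intros)
    from has_derivative_compose[OF this that] have "((\<lambda>z. F (b - cnj z)) has_derivative (\<lambda>h. c * (- cnj h) + d * (- h))) (at z)"
      by simp
    then show ?thesis by (rule has_derivative_mult_right)
  qed
  show ?thesis
    using D[OF *(1)[OF assms(2)], of _ 1] D[OF *(2)[OF assms(2)], of _ "-1"] D[OF *(3)[OF assms(2)], of _ "-1"]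
    by (intro has_wirtinger_laplacianI[where A="\<lambda>z. (-1) * B (b - cnj z)" and B="\<lambda>z. (-1) * A (b - cnj z)"
       and ?A1.0="\<lambda>z. B2 (b - cnj z)" and ?B2.0="\<lambda>z. A1 (b - cnj z)"])
      (simp_all add: algebra_simps)
qed

section \<open>The sign of the Laplacian at a maximum\<close>

lemma second_derivative_nonpos_at_max:
  fixes \<phi> :: "real \<Rightarrow> real"
  assumes r: "r > 0" and D: "\<And>s. \<bar>s\<bar> < r \<Longrightarrow> (\<phi> has_real_derivative \<phi>' s) (at s)"
    and D2: "(\<phi>' has_real_derivative d) (at 0)" and max: "\<And>s. \<bar>s\<bar> < r \<Longrightarrow> \<phi> s \<le> \<phi> 0"
  shows "d \<le> 0"
proof (rule ccontr)
  assume "\<not> d \<le> 0"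
  then obtain e where e: "e > 0" "\<And>h. 0 < h \<Longrightarrow> h < e \<Longrightarrow> \<phi>' 0 < \<phi>' h"
    using DERIV_pos_inc_right[OF D2] by auto
  have 0: "\<phi>' 0 = 0"
    by (rule DERIV_local_max[OF D r]) (use r max in auto)
  define s where "s = min e r / 2"
  have s: "0 < s" "s < e" "s < r" using e r by (auto simp: s_def)
  have "\<phi> 0 < \<phi> s"
  proof (rule DERIV_pos_imp_increasing_open[OF s(1)])
    show "\<exists>y. (\<phi> has_real_derivative y) (at x) \<and> 0 < y" if "0 < x" "x < s" for x
      using D[of x] e(2)[of x] 0 that s by auto
    show "continuous_on {0..s} \<phi>"
      by (rule DERIV_continuous_on[of _ _ \<phi>']) (use D s in \<open>auto intro: has_field_derivative_at_within\<close>)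
  qed
  then show False using max[of s] s by auto
qed

lemma wirtinger_laplacian_nonpos_at_max:
  assumes f: "has_wirtinger_laplacian f L S" and S: "open S" "\<zeta> \<in> S"
    and max: "\<And>z. z \<in> S \<Longrightarrow> Re (f z) \<le> Re (f \<zeta>)"
  shows "Re (L \<zeta>) \<le> 0"
proof -
  from f obtain A B A1 B2 where *:
    "\<And>z. z \<in> S \<Longrightarrow> (f has_derivative (\<lambda>h. A z * h + B z * cnj h)) (at z)"
    "\<And>z. z \<in> S \<Longrightarrow> (A has_derivative (\<lambda>h. A1 z * h + L z * cnj h)) (at z)"
    "\<And>z. z \<in> S \<Longrightarrow> (B has_derivative (\<lambda>h. L z * h + B2 z * cnj h)) (at z)"
    by (rule has_wirtinger_laplacianE) (rule that)
  obtain r where r: "r > 0" "ball \<zeta> r \<subseteq> S" using S openE by blast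
  have D: "((\<lambda>s. Re (k * F (\<zeta> + of_real s * e))) has_real_derivative Re (k * (c * e + d * cnj e))) (at s)"
    if "(F has_derivative (\<lambda>h. c * h + d * cnj h)) (at (\<zeta> + of_real s * e))" for F c d s k e
  proof -
    have "((\<lambda>s. \<zeta> + of_real s * e) has_derivative (\<lambda>t. of_real t * e)) (at s)"
      by (auto intro!: derivative_eq_intros)
    from has_derivative_compose[OF this that]
    have "((\<lambda>s. Re (k * F (\<zeta> + of_real s * e))) has_derivative (\<lambda>t. Re (k * (c * (of_real t * e) + d * cnj (of_real t * e))))) (at s)"
      by (intro has_derivative_Re has_derivative_mult_right)
    then show ?thesis unfolding has_field_derivative_def
      by (rule has_derivative_eq_rhs) (auto simp: algebra_simps)
  qed
  have "Re (e * (A1 \<zeta> * e + L \<zeta> * cnj e)) + Re (cnj e * (L \<zeta> * e + B2 \<zeta> * cnj e)) \<le> 0" if e: "norm e = 1" for e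
  proof (rule second_derivative_nonpos_at_max[OF r(1)])
    fix s :: real assume s: "\<bar>s\<bar> < r"
    then have m: "\<zeta> + of_real s * e \<in> S" using e r by (auto simp: dist_norm norm_mult)
    show "((\<lambda>s. Re (1 * f (\<zeta> + of_real s * e))) has_real_derivative
        Re (e * A (\<zeta> + of_real s * e)) + Re (cnj e * B (\<zeta> + of_real s * e))) (at s)"
      using D[OF *(1)[OF m], of 1] by (simp add: algebra_simps)
    show "Re (1 * f (\<zeta> + of_real s * e)) \<le> Re (1 * f (\<zeta> + of_real 0 * e))"
      using max[OF m] by simp
  next
    show "((\<lambda>s. Re (e * A (\<zeta> + of_real s * e)) + Re (cnj e * B (\<zeta> + of_real s * e))) has_real_derivative
      Re (e * (A1 \<zeta> * e + L \<zeta> * cnj e)) + Re (cnj e * (L \<zeta> * e + B2 \<zeta> * cnj e))) (at 0)"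
      by (rule DERIV_add) (rule D; use *(2,3) S in simp)+
  qed
  \<comment> \<open>The terms with \<open>A1\<close> and \<open>B2\<close> change sign from
    direction 1 to direction i, so the sum of the two inequalities is
    \<open>4 * Re (L \<zeta>) \<le> 0\<close>.\<close>
  from this[of 1] this[of \<i>] show ?thesis by (simp add: algebra_simps)
qed

lemma maximum_principle:
  assumes K: "compact K" "K \<noteq> {}" and f: "continuous_on K f"
    and L: "has_wirtinger_laplacian f L (interior K)" "\<And>z. z \<in> interior K \<Longrightarrow> Re (L z) > 0"
  obtains \<zeta> where "\<zeta> \<in> K - interior K" "\<And>z. z \<in> K \<Longrightarrow> Re (f z) \<le> Re (f \<zeta>)"
proof -
  have "continuous_on K (\<lambda>z. Re (f z))" by (intro continuous_intros f)
  then obtain \<zeta> where \<zeta>: "\<zeta> \<in> K" "\<And>z. z \<in> K \<Longrightarrow> Re (f z) \<le> Re (f \<zeta>)"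
    using continuous_attains_sup[OF K] by blast
  moreover have "\<zeta> \<notin> interior K"
    using wirtinger_laplacian_nonpos_at_max[OF L(1) open_interior, of \<zeta>] L(2)[of \<zeta>] \<zeta> interior_subset
    by (metis in_mono linorder_not_less)
  ultimately show ?thesis using that by blast
qed

text \<open>Reduces norm estimates to one-sided estimates of real parts, which the maximum principle
  can give: multiplication of a function by a unimodular constant preserves the bounds assumed of
  it.\<close>

lemma norm_le_by_rotation:
  assumes "\<And>a. norm a = 1 \<Longrightarrow> Re (a * x) \<le> b"
  shows "norm (x::complex) \<le> b"
proof (cases "x = 0")
  case True
  then show ?thesis using assms[of 1] by simp
next
  case False
  have "norm (cnj x / norm x) = 1" using False by (simp add: norm_divide)
  moreover have "cnj x / norm x * x = norm x"
    using False complex_norm_square[of x] by (simp add: field_simps power2_eq_square)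
  ultimately show ?thesis using assms[of "cnj x / norm x"] by simp
qed

lemma norm_le_dirichlet:
  assumes v: "continuous_on (cball 0 1) v" "has_wirtinger_laplacian v L (ball 0 1)"
    and 0: "\<And>\<zeta>. norm \<zeta> = 1 \<Longrightarrow> v \<zeta> = 0"
    and M: "\<And>z. norm z < 1 \<Longrightarrow> norm (L z) \<le> M" and z: "norm z \<le> 1"
  shows "norm (v z) \<le> M * (1 - (norm z)\<^sup>2)"
proof (rule norm_le_by_rotation)
  fix a :: complex assume a: "norm a = 1"
  show "Re (a * v z) \<le> M * (1 - (norm z)\<^sup>2)"
  proof (rule field_le_epsilon)
    fix e :: real assume e: "e > 0"
    \<comment> \<open>This is \<open>a * v z\<close> minus the comparison function $(M+e)(1-|z|^2)$,
      which vanishes on the circle and has Laplacian $-(M+e)$.\<close>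
    let ?f = "\<lambda>z. 1 * (a * v z + (of_real (M + e)) * (z * cnj z)) + (- of_real (M + e)) * 1"
    let ?L = "\<lambda>z. 1 * (a * L z + (of_real (M + e)) * 1) + (- of_real (M + e)) * 0"
    have lap: "has_wirtinger_laplacian ?f ?L (interior (cball 0 1))"
      unfolding interior_cball
      by (intro has_wirtinger_laplacian_lincomb has_wirtinger_laplacian_norm_square has_wirtinger_laplacian_holomorphic v) auto
    have pos: "Re (?L z) > 0" if "z \<in> interior (cball 0 1)" for z
      using M[of z] that abs_Re_le_cmod[of "a * L z"] a e by (simp add: norm_mult)
    have cont: "continuous_on (cball 0 1) ?f" by (intro continuous_intros v)
    obtain \<zeta> where \<zeta>: "\<zeta> \<in> cball 0 1 - interior (cball 0 1)" "\<And>z. z \<in> cball 0 1 \<Longrightarrow> Re (?f z) \<le> Re (?f \<zeta>)"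
      by (rule maximum_principle[OF compact_cball _ cont lap pos]) auto
    have "\<zeta> * cnj \<zeta> = 1" "norm \<zeta> = 1" using \<zeta>(1) by (auto simp: complex_norm_square[symmetric])
    then have "Re (?f \<zeta>) = 0" using 0 by simp
    then have "Re (?f z) \<le> 0" using \<zeta>(2)[of z] z by simp
    then have "Re (a * v z) \<le> (M + e) * (1 - (norm z)\<^sup>2)"
      by (simp add: complex_norm_square[symmetric] algebra_simps flip: of_real_power of_real_mult)
    also have "\<dots> \<le> M * (1 - (norm z)\<^sup>2) + e" using e by (simp add: algebra_simps)
    finally show "Re (a * v z) \<le> M * (1 - (norm z)\<^sup>2) + e" .
  qed
qed

section \<open>The gradient of a solution of the Dirichlet problem\<close>

lemma derivative_le_of_le_linear:
  fixes \<psi> :: "real \<Rightarrow> real"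
  assumes D: "(\<psi> has_real_derivative l) (at 0)" and r: "r > 0"
    and le: "\<And>s. 0 < s \<Longrightarrow> s < r \<Longrightarrow> \<psi> s \<le> \<psi> 0 + C * s"
  shows "l \<le> C"
proof (rule ccontr)
  assume "\<not> l \<le> C"
  have "((\<lambda>s. \<psi> s - C * s) has_real_derivative (l - C)) (at 0)"
    by (auto intro!: derivative_eq_intros D)
  from DERIV_pos_inc_right[OF this] \<open>\<not> l \<le> C\<close> obtain d where
    d: "d > 0" "\<And>h. 0 < h \<Longrightarrow> h < d \<Longrightarrow> \<psi> 0 < \<psi> h - C * h" by auto
  define h where "h = min d r / 2"
  have "0 < h" "h < d" "h < r" using d(1) r by (auto simp: h_def)
  then show False using d(2)[of h] le[of h] by simp
qed

text \<open>With $d = Re z_0 \<ge> 0$ the mirror image of the cap to the right of $z_0$ stays in the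
  disc. To twice the derivative the arc contributes $4dM$ and the Laplacian $4M(1-d)$, so the
  position of $z_0$ drops out. The bound is the gradient of $M(1-|z|^2)$ at the circle.\<close>

lemma Re_dirichlet_derivative_le:
  assumes v: "continuous_on (cball 0 1) v" "has_wirtinger_laplacian v L (ball 0 1)"
    and 0: "\<And>\<zeta>. norm \<zeta> = 1 \<Longrightarrow> v \<zeta> = 0"
    and M: "\<And>z. norm z < 1 \<Longrightarrow> norm (L z) \<le> M"
    and z0: "norm z0 < 1" "Re z0 \<ge> 0" and D: "(v has_derivative D) (at z0)"
  shows "Re (D 1) \<le> 2 * M"
proof (rule field_le_epsilon)
  fix e0 :: real assume "e0 > 0"
  define e where "e = e0 / 2"
  have e: "e > 0" using \<open>e0 > 0\<close> by (simp add: e_def)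
  have M0: "M \<ge> 0" using order_trans[OF norm_ge_zero M[of 0]] by simp
  define d where "d = Re z0"
  have d: "d \<ge> 0" "d < 1" using z0 abs_Re_le_cmod[of z0] by (auto simp: d_def)
  define K where "K = cball 0 1 \<inter> {z. Re z \<ge> d}"
  have K: "compact K" "K \<noteq> {}"
  proof -
    show "compact K" by (auto simp: K_def closed_halfspace_Re_ge intro!: compact_Int_closed)
    have "z0 \<in> K" using z0 by (simp add: K_def d_def)
    then show "K \<noteq> {}" by blast
  qed
  have intK: "norm z < 1" "Re z \<ge> d" if "z \<in> interior K" for z
    using that interior_subset[of K] by (auto simp: K_def)
  have bdK: "norm z = 1 \<or> Re z = d" if "z \<in> K - interior K" for z
  proof (rule ccontr)
    assume "\<not> ?thesis"
    then have "z \<in> ball 0 1 \<inter> {z. Re z > d}" using that by (auto simp: K_def)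
    moreover have "open (ball 0 1 \<inter> {z. Re z > d})" by (intro open_Int open_halfspace_Re_gt open_ball)
    moreover have "ball 0 1 \<inter> {z. Re z > d} \<subseteq> K" by (auto simp: K_def)
    ultimately show False using that interiorI by blast
  qed
  \<comment> \<open>On the arc $|z| = 1$ this says $1 - |z^*|^2 = 4d(Re z - d)$, so the bound for
    \<open>v\<close> at the mirror point is linear in the distance to the line.\<close>
  have refl: "(norm (of_real (2*d) - cnj z))\<^sup>2 = (norm z)\<^sup>2 - 4 * d * (Re z - d)" for z
    unfolding cmod_power2 by (simp add: power2_eq_square algebra_simps)
  have refl_le: "norm (of_real (2*d) - cnj z) \<le> norm z" if "Re z \<ge> d" for z
  proof (rule power2_le_imp_le)
    have "0 \<le> 4 * d * (Re z - d)" using that d by (intro mult_nonneg_nonneg) auto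
    then show "(norm (of_real (2*d) - cnj z))\<^sup>2 \<le> (norm z)\<^sup>2" using refl[of z] by linarith
  qed simp
  \<comment> \<open>Write $x = Re z$. Since $Re(z^2) + |z|^2 = 2x^2$, adding $2(M+e)|z|^2$ to
    \<open>p\<close> gives the real part $-4dM(x-d) - 4(M+e)(x-d)(1-x)$. The first term absorbs the
    values on the arc; the second has Laplacian $2(M+e)$, more than the $2M$ that the two values of
    \<open>L\<close> can contribute.\<close>
  define p where "p = (\<lambda>z::complex. of_real (-4*d*M) * (z - of_real d) + of_real (2*(M+e)) * z\<^sup>2
      - of_real (4*(M+e)) * (of_real (1+d) * z - of_real d))"
  let ?f = "\<lambda>z. 1 * (1 * v z + (-1) * v (of_real (2*d) - cnj z)) + 1 * (1 * p z + of_real (2*(M+e)) * (z * cnj z))"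
  let ?L = "\<lambda>z. 1 * (1 * L z + (-1) * L (of_real (2*d) - cnj z)) + 1 * (1 * 0 + of_real (2*(M+e)) * 1)"
  have lap: "has_wirtinger_laplacian ?f ?L (interior K)"
  proof (intro has_wirtinger_laplacian_lincomb has_wirtinger_laplacian_norm_square has_wirtinger_laplacian_holomorphic)
    show "has_wirtinger_laplacian v L (interior K)"
      using v(2) by (rule has_wirtinger_laplacian_subset) (use intK in auto)
    show "has_wirtinger_laplacian (\<lambda>z. v (of_real (2*d) - cnj z)) (\<lambda>z. L (of_real (2*d) - cnj z)) (interior K)"
      using v(2) by (rule has_wirtinger_laplacian_reflect) (simp only: mem_ball_0 le_less_trans[OF refl_le[OF intK(2)] intK(1)])
    show "p holomorphic_on interior K" unfolding p_def by (intro holomorphic_intros)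
  qed auto
  have pos: "Re (?L z) > 0" if "z \<in> interior K" for z
    using M[of z] M[of "of_real (2*d) - cnj z"] intK[OF that] refl_le[of z] e
      abs_Re_le_cmod[of "L z"] abs_Re_le_cmod[of "L (of_real (2*d) - cnj z)"] by simp
  have c1: "continuous_on K v" by (rule continuous_on_subset[OF v(1)]) (auto simp: K_def)
  have c2: "continuous_on K (\<lambda>z. v (of_real (2*d) - cnj z))"
  proof (rule continuous_on_compose2[OF v(1)])
    show "(\<lambda>z. of_real (2*d) - cnj z) ` K \<subseteq> cball 0 1"
    proof (rule image_subsetI)
      fix z assume "z \<in> K"
      then show "of_real (2*d) - cnj z \<in> cball 0 1"
        using refl_le[of z] by (simp add: K_def)
    qed
  qed (intro continuous_intros)
  have cont: "continuous_on K ?f" unfolding p_def by (intro continuous_intros c1 c2)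
  obtain \<zeta> where \<zeta>: "\<zeta> \<in> K - interior K" "\<And>z. z \<in> K \<Longrightarrow> Re (?f z) \<le> Re (?f \<zeta>)"
    by (rule maximum_principle[OF K cont lap pos]) auto
  have Ref: "Re (?f z) = Re (v z) - Re (v (of_real (2*d) - cnj z)) - 4*d*M*(Re z - d) - 4*(M+e)*(Re z - d)*(1 - Re z)" for z
    by (simp add: p_def power2_eq_square algebra_simps)
  have "Re (?f \<zeta>) \<le> 0"
  proof (cases "Re \<zeta> = d")
    case True
    then have "of_real (2*d) - cnj \<zeta> = \<zeta>" by (simp add: complex_eq_iff)
    then show ?thesis unfolding Ref using True by simp
  next
    case False
    then have n: "norm \<zeta> = 1" and x: "Re \<zeta> \<ge> d" using bdK[OF \<zeta>(1)] \<zeta>(1) by (auto simp: K_def)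
    have x1: "Re \<zeta> \<le> 1" using n abs_Re_le_cmod[of \<zeta>] by simp
    have le1: "norm (of_real (2*d) - cnj \<zeta>) \<le> 1" using refl_le[OF x] n by simp
    have "norm (v (of_real (2*d) - cnj \<zeta>)) \<le> M * (4 * d * (Re \<zeta> - d))"
      using norm_le_dirichlet[OF v 0 M le1] refl[of \<zeta>] n by simp
    moreover have "0 \<le> 4*(M+e)*(Re \<zeta> - d)*(1 - Re \<zeta>)"
      using M0 e x x1 by (intro mult_nonneg_nonneg) auto
    ultimately show ?thesis unfolding Ref using 0[OF n] abs_Re_le_cmod[of "v (of_real (2*d) - cnj \<zeta>)"]
      by (simp add: algebra_simps)
  qed
  then have le0: "Re (?f z) \<le> 0" if "z \<in> K" for z using \<zeta>(2)[OF that] by linarith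
  \<comment> \<open>The mirror image of \<open>z0 + s\<close> is \<open>z0 - s\<close>, so the
    reflected difference along the horizontal line through \<open>z0\<close> has derivative
    \<open>2 * Re (D 1)\<close> at 0.\<close>
  have "2 * Re (D 1) \<le> 4*d*M + 4*(M+e)*(1-d)"
  proof (rule derivative_le_of_le_linear[where r="1 - norm z0"])
    have lin: "linear D" using D has_derivative_linear by blast
    have 1: "((\<lambda>s. v (z0 + of_real s)) has_derivative (\<lambda>t. D (of_real t))) (at 0)"
      by (rule has_derivative_compose[of "\<lambda>s. z0 + of_real s"]) (use D in \<open>auto intro!: derivative_eq_intros\<close>)
    have 2: "((\<lambda>s. v (z0 - of_real s)) has_derivative (\<lambda>t. D (- of_real t))) (at 0)"
      by (rule has_derivative_compose[of "\<lambda>s. z0 - of_real s"]) (use D in \<open>auto intro!: derivative_eq_intros\<close>)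
    have Dt: "D (of_real t) = t *\<^sub>R D 1" "D (- of_real t) = (-t) *\<^sub>R D 1" for t
      using linear_cmul[OF lin, of t 1] linear_cmul[OF lin, of "-t" 1] by (simp_all add: scaleR_conv_of_real)
    show "((\<lambda>s. Re (v (z0 + of_real s)) - Re (v (z0 - of_real s))) has_real_derivative 2 * Re (D 1)) (at 0)"
      unfolding has_field_derivative_def
      by (rule has_derivative_eq_rhs[OF has_derivative_diff[OF has_derivative_Re[OF 1] has_derivative_Re[OF 2]]])
        (simp add: Dt fun_eq_iff algebra_simps)
    show "1 - norm z0 > 0" using z0 by simp
    fix s :: real assume s: "0 < s" "s < 1 - norm z0"
    have "norm (z0 + of_real s) \<le> 1" using norm_triangle_ineq[of z0 "of_real s"] s by simp
    then have "z0 + of_real s \<in> K" using s by (simp add: K_def d_def)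
    note le0[OF this, unfolded Ref]
    moreover have "of_real (2*d) - cnj (z0 + of_real s) = z0 - of_real s" by (simp add: complex_eq_iff d_def)
    ultimately have "Re (v (z0 + of_real s)) - Re (v (z0 - of_real s)) \<le> 4 * d * M * s + 4 * (M + e) * s * (1 - d - s)"
      by (simp add: d_def algebra_simps)
    also have "\<dots> \<le> (4*d*M + 4*(M+e)*(1-d)) * s" using s M0 e by (simp add: algebra_simps)
    finally show "Re (v (z0 + of_real s)) - Re (v (z0 - of_real s)) \<le>
      Re (v (z0 + of_real 0)) - Re (v (z0 - of_real 0)) + (4*d*M + 4*(M+e)*(1-d)) * s" by simp
  qed
  also have "\<dots> \<le> 4 * M + 4 * e" using d e by (simp add: algebra_simps)
  finally show "Re (D 1) \<le> 2 * M + e0" by (simp add: e_def)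
qed

lemma norm_dirichlet_derivative_le:
  assumes v: "continuous_on (cball 0 1) v" "has_wirtinger_laplacian v L (ball 0 1)"
    and 0: "\<And>\<zeta>. norm \<zeta> = 1 \<Longrightarrow> v \<zeta> = 0"
    and M: "\<And>z. norm z < 1 \<Longrightarrow> norm (L z) \<le> M"
    and z0: "norm z0 < 1" and D: "(v has_derivative D) (at z0)" and \<xi>: "norm \<xi> = 1"
  shows "norm (D \<xi>) \<le> 2 * M"
proof (rule norm_le_by_rotation)
  fix a :: complex assume a: "norm a = 1"
  have *: "Re (a * D \<xi>) \<le> 2 * M" if a: "norm a = 1" and \<xi>: "norm \<xi> = 1" and pos: "Re (cnj \<xi> * z0) \<ge> 0" for a \<xi>
  proof -
    have \<xi>1: "\<xi> * cnj \<xi> = 1" using \<xi> by (simp add: complex_norm_square[symmetric])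
    let ?v = "\<lambda>z. a * v (\<xi> * z + 0) + 0 * 0" and ?L = "\<lambda>z. a * (\<xi> * cnj \<xi> * L (\<xi> * z + 0)) + 0 * 0"
    have "Re (a * D (\<xi> * 1)) \<le> 2 * M"
    proof (rule Re_dirichlet_derivative_le[where v="?v" and L="?L" and D="\<lambda>h. a * D (\<xi> * h)"])
      show "continuous_on (cball 0 1) ?v"
        by (intro continuous_intros continuous_on_compose2[OF v(1)]) (auto simp: norm_mult \<xi>)
      show "has_wirtinger_laplacian ?v ?L (ball 0 1)"
        by (intro has_wirtinger_laplacian_lincomb has_wirtinger_laplacian_affine[OF v(2)] has_wirtinger_laplacian_holomorphic)
          (auto simp: norm_mult \<xi>)
      show "norm (cnj \<xi> * z0) < 1" using z0 \<xi> by (simp add: norm_mult)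
      have z0': "\<xi> * (cnj \<xi> * z0) + 0 = z0" using \<xi>1 by (simp flip: mult.assoc)
      have aff: "((\<lambda>z. \<xi> * z + 0) has_derivative (\<lambda>h. \<xi> * h)) (at (cnj \<xi> * z0))"
        by (auto intro!: derivative_eq_intros)
      have "(v has_derivative D) (at (\<xi> * (cnj \<xi> * z0) + 0))" unfolding z0' by (fact D)
      from has_derivative_compose[OF aff this]
      show "(?v has_derivative (\<lambda>h. a * D (\<xi> * h))) (at (cnj \<xi> * z0))"
        by (auto intro!: has_derivative_mult_right)
    qed (use a \<xi> \<xi>1 0 M pos in \<open>auto simp: norm_mult\<close>)
    then show ?thesis by simp
  qed
  show "Re (a * D \<xi>) \<le> 2 * M"
  proof (cases "Re (cnj \<xi> * z0) \<ge> 0")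
    case True
    then show ?thesis using *[OF a \<xi>] by simp
  next
    \<comment> \<open>Negating both \<open>a\<close> and \<open>\<xi>\<close> leaves
      \<open>a * D \<xi>\<close> unchanged and makes the real part of \<open>cnj \<xi> * z0\<close>
      positive.\<close>
    case False
    have "D (- \<xi>) = - D \<xi>" using D has_derivative_linear linear_neg by blast
    then show ?thesis using *[of "-a" "-\<xi>"] a \<xi> False by simp
  qed
qed

section \<open>Oscillation of a solution of the Neumann problem\<close>

text \<open>On this interval tan is convex and therefore lies below its chord.\<close>

lemma tan_le_on_quarter_pi:
  assumes "0 \<le> x" "x \<le> pi / 4"
  shows "tan x \<le> 4 / pi * x"
proof -
  have "convex_on {0..pi/4} tan"
  proof (rule convex_on_realI)
    have cos_pos: "0 < cos y" if "y \<in> {0..pi/4}" for y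
    proof -
      have "0 \<le> y" "y \<le> pi / 4" using that by auto
      then show ?thesis using pi_gt_zero by (intro cos_gt_zero_pi) linarith+
    qed
    show "(tan has_real_derivative inverse ((cos y)\<^sup>2)) (at y)" if "y \<in> {0..pi/4}" for y
      using cos_pos[OF that] by (intro DERIV_tan) auto
    show "inverse ((cos y)\<^sup>2) \<le> inverse ((cos z)\<^sup>2)" if "y \<in> {0..pi/4}" "z \<in> {0..pi/4}" "y \<le> z" for y z
      using that cos_pos[OF that(2)] by (intro le_imp_inverse_le power_mono cos_monotone_0_pi_le) auto
  qed auto
  from convex_onD[OF this, of "4 / pi * x" 0 "pi / 4"] assms show ?thesis
    by (simp add: tan_45 field_simps)
qed

text \<open>The left side is the normal derivative of the real part of
  \<open>neumann_barrier\<close> at \<open>cis t\<close>. With $x = t/2$ the claim becomes the chord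
  estimate for tan multiplied by $2 sin x cos x$. The case $t = pi/2$ shows that $2/pi$ is the
  smallest possible factor.\<close>

lemma cos_plus_angle_sin_ge_1:
  assumes "\<bar>t\<bar> \<le> pi / 2"
  shows "cos t + 2 / pi * (t * sin t) \<ge> 1"
proof -
  have *: "cos t + 2 / pi * (t * sin t) \<ge> 1" if t: "0 \<le> t" "t \<le> pi / 2" for t
  proof -
    define x where "x = t / 2"
    have x: "0 \<le> x" "x \<le> pi / 4" "t = 2 * x" using t by (auto simp: x_def)
    have c: "cos x > 0" using x pi_gt_zero by (intro cos_gt_zero_pi) linarith+
    have s: "sin x \<ge> 0" using x by (intro sin_ge_zero) auto
    have "2 * (sin x * cos x) * tan x \<le> 2 * (sin x * cos x) * (4 / pi * x)"
      using tan_le_on_quarter_pi[OF x(1,2)] c s by (intro mult_left_mono) auto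
    moreover have "2 * (sin x * cos x) * tan x = 2 * (sin x)\<^sup>2"
      using c by (simp add: tan_def power2_eq_square)
    moreover have "cos t = 1 - 2 * (sin x)\<^sup>2" "sin t = 2 * (sin x * cos x)"
      unfolding x(3) by (simp_all add: cos_double_sin sin_double)
    moreover from this have "2 / pi * (t * sin t) = 2 * (sin x * cos x) * (4 / pi * x)"
      using x(3) by (simp add: field_simps)
    ultimately show ?thesis by linarith
  qed
  show ?thesis using *[of t] *[of "-t"] assms by (cases "t \<ge> 0") auto
qed

lemma polar_Ln:
  assumes "z \<noteq> 0"
  shows "Re z = norm z * cos (Im (Ln z))" "Im z = norm z * sin (Im (Ln z))"
proof -
  have "z = exp (Ln z)" using assms by simp
  then show "Re z = norm z * cos (Im (Ln z))" "Im z = norm z * sin (Im (Ln z))"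
    by (metis Re_exp norm_exp_eq_Re) (metis Im_exp \<open>z = exp (Ln z)\<close> norm_exp_eq_Re)
qed

text \<open>The real part is harmonic in the right half disc, nonnegative on the diameter, and has normal
  derivative at least $1$ on the half circle. A barrier that is smooth at the corners $\pm i$ could
  not do this, since the normal is tangential to the diameter there; hence the term $z \log z$.\<close>

definition neumann_barrier :: "complex \<Rightarrow> complex" where
  "neumann_barrier z = of_real (- 2 / pi) * (z * Ln z) + of_real (1 + 2 / pi) * z"

lemma Re_neumann_barrier:
  assumes "z \<noteq> 0"
  shows "Re (neumann_barrier z) =
    2 / pi * (Im z * Im (Ln z) - Re z * ln (norm z)) + (1 + 2 / pi) * Re z"
  using assms by (simp add: neumann_barrier_def algebra_simps diff_divide_distrib)

text \<open>The value there is in fact $|Im z|$. A differentiable barrier that vanishes on the whole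
  diameter is ruled out: at the corners its derivative along the circle's normal, which runs along
  the diameter, would be 0.\<close>

lemma Re_neumann_barrier_imaginary_axis:
  assumes "Re z = 0"
  shows "Re (neumann_barrier z) \<ge> 0"
proof (cases "z = 0")
  case False
  define t where "t = Im (Ln z)"
  have "\<bar>t\<bar> \<le> pi / 2" using Re_Ln_pos_le[OF False] assms by (simp add: t_def)
  then have "0 \<le> t * sin t"
    using sin_ge_zero[of t] sin_ge_zero[of "-t"] pi_gt_zero
    by (cases "t \<ge> 0") (auto intro!: mult_nonneg_nonneg mult_nonpos_nonpos)
  then have "0 \<le> Im (Ln z) * sin (Im (Ln z))" by (simp add: t_def)
  then have "0 \<le> norm z * (Im (Ln z) * sin (Im (Ln z)))" by simp
  then show ?thesis using assms by (simp add: Re_neumann_barrier[OF False] polar_Ln(2)[OF False] mult.left_commute)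
qed (simp add: neumann_barrier_def)

text \<open>A bound linear in \<open>Re z\<close> is wanted because it will be averaged over all
  diameters. It comes from $sin x \<le> x$ at $x = pi/2 - |t|$ and $ln x \<le> x - 1$ at $x =
  1/r$.\<close>

lemma Re_neumann_barrier_le:
  assumes "norm z \<le> 1" "Re z \<ge> 0"
  shows "Re (neumann_barrier z) \<le> 1 + Re z"
proof (cases "z = 0")
  case False
  define t where "t = Im (Ln z)"
  define r where "r = norm z"
  have r: "0 < r" "r \<le> 1" using False assms by (auto simp: r_def)
  have t: "\<bar>t\<bar> \<le> pi / 2" using Re_Ln_pos_le[OF False] assms unfolding t_def by blast
  have p: "Re z = r * cos t" "Im z = r * sin t" using polar_Ln[OF False] by (simp_all add: r_def t_def)
  have c: "cos t \<ge> 0" using t by (intro cos_ge_zero) auto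
  have "t * sin t \<le> \<bar>t\<bar>"
    using abs_sin_le_one[of t] mult_left_mono[of "\<bar>sin t\<bar>" 1 "\<bar>t\<bar>"] abs_ge_self[of "t * sin t"]
    by (simp add: abs_mult)
  moreover have "\<bar>t\<bar> \<le> pi / 2 - cos t"
  proof -
    have "sin (pi / 2 - \<bar>t\<bar>) = cos t" using cos_sin_eq[of "\<bar>t\<bar>"] by simp
    then show ?thesis using sin_x_le_x[of "pi / 2 - \<bar>t\<bar>"] t by linarith
  qed
  ultimately have "r * (t * sin t) \<le> r * (pi / 2 - cos t)" using r by (intro mult_left_mono) auto
  then have 1: "Im z * t \<le> r * pi / 2 - Re z" using p by (simp add: algebra_simps)
  have "ln (inverse r) \<le> inverse r - 1" using r by (intro ln_le_minus_one) auto
  then have "- ln r \<le> inverse r - 1" using r by (simp add: ln_inverse)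
  then have "r * cos t * (- ln r) \<le> r * cos t * (inverse r - 1)"
    using r c by (intro mult_left_mono) auto
  also have "\<dots> = cos t * (1 - r)" using r by (simp add: field_simps)
  also have "\<dots> \<le> 1 - r" using r mult_right_mono[of "cos t" 1 "1 - r"] by simp
  finally have 2: "- (Re z * ln r) \<le> 1 - r" using p by simp
  have "2 / pi * (Im z * t - Re z * ln r) \<le> 2 / pi * (r * pi / 2 - Re z + (1 - r))"
    using 1 2 by (intro mult_left_mono) auto
  also have "\<dots> = r + 2 / pi * (1 - r) - 2 / pi * Re z" by (simp add: field_simps)
  also have "\<dots> \<le> r + 1 * (1 - r) - 2 / pi * Re z"
    using r pi_gt3 mult_right_mono[of "2 / pi" 1 "1 - r"] by simp
  finally show ?thesis unfolding Re_neumann_barrier[OF False] t_def[symmetric] r_def[symmetric]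
    by (simp add: algebra_simps)
qed (simp add: neumann_barrier_def)

text \<open>The branch point 0 lies on the diameter, hence on the boundary of the half disc, where
  the maximum principle needs the barrier to be continuous.\<close>

lemma isCont_times_Ln_0: "isCont (\<lambda>z. z * Ln z) 0"
proof -
  have "((\<lambda>z::complex. z * Ln z) \<longlongrightarrow> 0) (at 0)"
  proof (rule Lim_null_comparison)
    show "((\<lambda>z::complex. \<bar>norm z * ln (norm z)\<bar> + norm z * pi) \<longlongrightarrow> 0) (at 0)"
    proof -
      have "((\<lambda>x::real. x * ln x) \<longlongrightarrow> 0) (at_right 0)" by real_asymp
      moreover have "filterlim (norm :: complex \<Rightarrow> real) (at_right 0) (at 0)"
        by (auto simp: filterlim_at eventually_at_filter intro!: tendsto_eq_intros)
      ultimately have "((\<lambda>z::complex. norm z * ln (norm z)) \<longlongrightarrow> 0) (at 0)"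
        by (rule filterlim_compose)
      from tendsto_add[OF tendsto_rabs_zero[OF this] tendsto_mult_left_zero[OF tendsto_norm_zero[OF tendsto_ident_at]]]
      show ?thesis by simp
    qed
    show "\<forall>\<^sub>F z::complex in at 0. norm (z * Ln z) \<le> \<bar>norm z * ln (norm z)\<bar> + norm z * pi"
    proof (rule eventually_at_filter[THEN iffD2], rule always_eventually, intro allI impI)
      fix z :: complex assume "z \<noteq> 0"
      have "\<bar>Im (Ln z)\<bar> \<le> pi" using mpi_less_Im_Ln[OF \<open>z \<noteq> 0\<close>] Im_Ln_le_pi[OF \<open>z \<noteq> 0\<close>] by simp
      then have "norm (Ln z) \<le> \<bar>ln (norm z)\<bar> + pi" using cmod_le[of "Ln z"] \<open>z \<noteq> 0\<close> by simp
      then have "norm z * norm (Ln z) \<le> norm z * (\<bar>ln (norm z)\<bar> + pi)" by (intro mult_left_mono) auto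
      then show "norm (z * Ln z) \<le> \<bar>norm z * ln (norm z)\<bar> + norm z * pi"
        by (simp add: norm_mult abs_mult algebra_simps)
    qed
  qed
  then show ?thesis by (simp add: isCont_def)
qed

lemma continuous_on_neumann_barrier: "continuous_on {z. Re z \<ge> 0} neumann_barrier"
proof -
  have "isCont (\<lambda>z. z * Ln z) z" if "Re z \<ge> 0" for z
  proof (cases "z = 0")
    case True
    then show ?thesis using isCont_times_Ln_0 by simp
  next
    case False
    then have "z \<notin> \<real>\<^sub>\<le>\<^sub>0" using that by (auto simp: complex_nonpos_Reals_iff complex_eq_iff)
    then show ?thesis by (intro continuous_intros) auto
  qed
  then have "continuous_on {z. Re z \<ge> 0} (\<lambda>z. z * Ln z)"
    by (intro continuous_at_imp_continuous_on) auto
  then show ?thesis unfolding neumann_barrier_def[abs_def]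
    by (intro continuous_on_add continuous_on_mult_left continuous_on_id)
qed

lemma holomorphic_on_neumann_barrier: "neumann_barrier holomorphic_on {z. Re z > 0}"
  unfolding neumann_barrier_def[abs_def]
  by (intro holomorphic_intros) (auto simp: complex_nonpos_Reals_iff)

text \<open>The coefficient $1 + 2/pi$ of the linear term is chosen so that the complex derivative
  is $1 - (2/pi) Ln z$. On the circle \<open>Ln \<zeta>\<close> is an imaginary number $it$, and the
  radial derivative becomes $cos t + (2/pi) t sin t$.\<close>

lemma neumann_barrier_radial_derivative:
  assumes "norm \<zeta> = 1" "Re \<zeta> > 0"
  shows "((\<lambda>r. Re (neumann_barrier (of_real r * \<zeta>))) has_real_derivative
    Re (\<zeta> * (1 - of_real (2 / pi) * Ln \<zeta>))) (at 1)"
    and "Re (\<zeta> * (1 - of_real (2 / pi) * Ln \<zeta>)) \<ge> 1"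
proof -
  have z: "\<zeta> \<noteq> 0" "\<zeta> \<notin> \<real>\<^sub>\<le>\<^sub>0" using assms by (auto simp: complex_nonpos_Reals_iff)
  have "(neumann_barrier has_field_derivative (1 - of_real (2 / pi) * Ln \<zeta>)) (at \<zeta>)"
    unfolding neumann_barrier_def[abs_def]
    by (rule derivative_eq_intros z(2) refl)+ (use z(1) in \<open>simp add: algebra_simps add_divide_distrib\<close>)
  then have "(neumann_barrier has_derivative (\<lambda>h. (1 - of_real (2 / pi) * Ln \<zeta>) * h)) (at (of_real 1 * \<zeta>))"
    by (simp add: has_field_derivative_def)
  moreover have "((\<lambda>r::real. of_real r * \<zeta>) has_derivative (\<lambda>t. of_real t * \<zeta>)) (at 1)"
    by (auto intro!: derivative_eq_intros)
  ultimately have "((\<lambda>r. neumann_barrier (of_real r * \<zeta>)) has_derivative (\<lambda>t. (1 - of_real (2 / pi) * Ln \<zeta>) * (of_real t * \<zeta>))) (at 1)"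
    using has_derivative_compose[of "\<lambda>r::real. of_real r * \<zeta>"] by blast
  from has_derivative_Re[OF this]
  show "((\<lambda>r. Re (neumann_barrier (of_real r * \<zeta>))) has_real_derivative
    Re (\<zeta> * (1 - of_real (2 / pi) * Ln \<zeta>))) (at 1)"
    unfolding has_field_derivative_def by (rule has_derivative_eq_rhs) (simp add: fun_eq_iff algebra_simps)
  have "\<bar>Im (Ln \<zeta>)\<bar> \<le> pi / 2" using Re_Ln_pos_le[OF z(1)] assms by simp
  from cos_plus_angle_sin_ge_1[OF this] show "Re (\<zeta> * (1 - of_real (2 / pi) * Ln \<zeta>)) \<ge> 1"
    using polar_Ln[OF z(1)] assms z by (simp add: algebra_simps)
qed


text \<open>The maximum of the difference minus the barriers can only lie on the diameter, where the
  difference vanishes. The negative quadratic term of the bound is kept because the constant 3 in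
  \<open>neumann_solution_bound\<close> depends on it.\<close>

lemma Re_neumann_reflection_le:
  assumes u: "continuous_on (cball 0 1) u" "has_wirtinger_laplacian u g (ball 0 1)"
    and G: "\<And>z. norm z < 1 \<Longrightarrow> norm (g z) \<le> G"
    and \<gamma>: "\<And>\<zeta>. norm \<zeta> = 1 \<Longrightarrow> has_outward_normal_derivative u (\<gamma> \<zeta>) \<zeta>"
    and \<Gamma>: "\<And>\<zeta>. norm \<zeta> = 1 \<Longrightarrow> norm (\<gamma> \<zeta>) \<le> \<Gamma>"
    and z: "norm z \<le> 1" "Re z \<ge> 0"
  shows "Re (u z - u (- cnj z)) \<le> 2 * \<Gamma> * (1 + Re z) + G * (7 * Re z - 11 / 3 * (Re z)\<^sup>2)"
proof (rule field_le_epsilon)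
  fix e0 :: real assume "e0 > 0"
  define e where "e = e0 / 20"
  have e: "e > 0" using \<open>e0 > 0\<close> by (simp add: e_def)
  have G0: "G \<ge> 0" using order_trans[OF norm_ge_zero G[of 0]] by simp
  have \<Gamma>0: "\<Gamma> \<ge> 0" using order_trans[OF norm_ge_zero \<Gamma>[of 1]] by simp
  define K where "K = cball 0 1 \<inter> {z. Re z \<ge> 0}"
  have K: "compact K" "K \<noteq> {}"
  proof -
    show "compact K" by (auto simp: K_def closed_halfspace_Re_ge intro!: compact_Int_closed)
    have "0 \<in> K" by (simp add: K_def)
    then show "K \<noteq> {}" by blast
  qed
  have intK: "norm z < 1" "Re z > 0" if "z \<in> interior K" for z
  proof -
    have "interior {z. Re z \<ge> 0} = {z. Re z > 0}"
      using interior_halfspace_ge[of "1::complex" 0] by (simp add: inner_complex_def)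
    then have "interior K = ball 0 1 \<inter> {z. Re z > 0}" by (simp add: K_def)
    then show "norm z < 1" "Re z > 0" using that by auto
  qed
  have bdK: "norm z = 1 \<or> Re z = 0" if "z \<in> K - interior K" for z
  proof (rule ccontr)
    assume "\<not> ?thesis"
    then have "z \<in> ball 0 1 \<inter> {z. Re z > 0}" using that by (auto simp: K_def)
    moreover have "open (ball 0 1 \<inter> {z. Re z > 0})" by (intro open_Int open_halfspace_Re_gt open_ball)
    moreover have "ball 0 1 \<inter> {z. Re z > 0} \<subseteq> K" by (auto simp: K_def)
    ultimately show False using that interiorI by blast
  qed
  \<comment> \<open>The reflected difference has normal derivative at most
    \<open>2 * \<Gamma>\<close> and Laplacian at most \<open>2 * G\<close> in modulus. The first is
    beaten by \<open>a\<close> times a slope of at least 1, the second by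
    \<open>2 * b\<close>.\<close>
  define a where "a = 2 * (\<Gamma> + e)"
  define b where "b = G + e"
  have ab: "a > 0" "b > 0" using e G0 \<Gamma>0 by (auto simp: a_def b_def)
  \<comment> \<open>The cubic term makes the normal derivative of $\Re p - 2|z|^2$ on the circle a perfect
    square times $4\Re z$, so that it is nonnegative on the half circle.\<close>
  define p where "p = (\<lambda>z::complex. 7 * z - 2 * z\<^sup>2 + z ^ 3 / 3)"
  let ?f = "\<lambda>z. 1 * (1 * u z + (-1) * u (0 - cnj z)) + 1 * (of_real (- a) * neumann_barrier z
     + of_real (- b) * (1 * p z + (-2) * (z * cnj z)))"
  let ?L = "\<lambda>z. 1 * (1 * g z + (-1) * g (0 - cnj z)) + 1 * (of_real (- a) * 0
     + of_real (- b) * (1 * 0 + (-2) * 1))"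
  have lap: "has_wirtinger_laplacian ?f ?L (interior K)"
  proof (intro has_wirtinger_laplacian_lincomb has_wirtinger_laplacian_norm_square has_wirtinger_laplacian_holomorphic)
    show "has_wirtinger_laplacian u g (interior K)"
      using u(2) by (rule has_wirtinger_laplacian_subset) (use intK in auto)
    show "has_wirtinger_laplacian (\<lambda>z. u (0 - cnj z)) (\<lambda>z. g (0 - cnj z)) (interior K)"
      using u(2) by (rule has_wirtinger_laplacian_reflect) (use intK in auto)
    show "p holomorphic_on interior K" unfolding p_def by (intro holomorphic_intros) auto
    show "neumann_barrier holomorphic_on interior K"
      by (rule holomorphic_on_subset[OF holomorphic_on_neumann_barrier]) (use intK in auto)
  qed auto
  have pos: "Re (?L z) > 0" if "z \<in> interior K" for z
    using G[of z] G[of "0 - cnj z"] intK[OF that] e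
      abs_Re_le_cmod[of "g z"] abs_Re_le_cmod[of "g (0 - cnj z)"] by (simp add: b_def)
  have c1: "continuous_on K u" by (rule continuous_on_subset[OF u(1)]) (auto simp: K_def)
  have c2: "continuous_on K (\<lambda>z. u (0 - cnj z))"
    by (rule continuous_on_compose2[OF u(1)]) (auto simp: K_def intro!: continuous_intros)
  have c3: "continuous_on K neumann_barrier"
    by (rule continuous_on_subset[OF continuous_on_neumann_barrier]) (auto simp: K_def)
  have cont: "continuous_on K ?f" unfolding p_def by (intro continuous_intros c1 c2 c3) auto
  obtain \<zeta> where \<zeta>: "\<zeta> \<in> K - interior K" "\<And>z. z \<in> K \<Longrightarrow> Re (?f z) \<le> Re (?f \<zeta>)"
    by (rule maximum_principle[OF K cont lap pos]) auto
  \<comment> \<open>This is $Re p - 2|z|^2$: the quadratic parts combine to $-4 (Re z)^2$, so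
    \<open>q\<close> vanishes on the diameter.\<close>
  define q where "q = (\<lambda>z. 7 * Re z - 4 * (Re z)\<^sup>2 + ((Re z)^3 - 3 * Re z * (Im z)\<^sup>2) / 3)"
  have Ref: "Re (?f z) = Re (u z) - Re (u (- cnj z)) - a * Re (neumann_barrier z) - b * q z" for z
    by (simp add: p_def q_def power2_eq_square power3_eq_cube algebra_simps add_divide_distrib diff_divide_distrib)
  \<comment> \<open>The corners count as points of the diameter, so radial derivatives are taken
    only where the real part is positive. There \<open>l < 0\<close> forces larger values just
    inside the circle.\<close>
  have "Re \<zeta> = 0"
  proof (rule ccontr)
    assume "Re \<zeta> \<noteq> 0"
    then have n: "norm \<zeta> = 1" and x: "Re \<zeta> > 0" using bdK[OF \<zeta>(1)] \<zeta>(1) by (auto simp: K_def)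
    have x1: "Re \<zeta> \<le> 1" using n abs_Re_le_cmod[of \<zeta>] by simp
    define \<phi> where "\<phi> = (\<lambda>r. Re (?f (of_real r * \<zeta>)))"
    define \<beta> where "\<beta> = Re (\<zeta> * (1 - of_real (2 / pi) * Ln \<zeta>))"
    define l where "l = Re (\<gamma> \<zeta>) - Re (\<gamma> (- cnj \<zeta>)) - a * \<beta> - b * (4 * Re \<zeta> * (1 - Re \<zeta>)\<^sup>2)"
    have d1: "((\<lambda>r. Re (u (of_real r * \<zeta>))) has_real_derivative Re (\<gamma> \<zeta>)) (at 1 within {0..1})"
      using \<gamma>[OF n] unfolding has_outward_normal_derivative_def has_field_derivative_def has_vector_derivative_def
      by (rule has_derivative_eq_rhs[OF has_derivative_Re]) (simp add: fun_eq_iff)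
    \<comment> \<open>The reflection carries the radius to \<open>\<zeta>\<close> onto the radius to
      \<open>- cnj \<zeta>\<close>, so the second one-sided derivative is radial as well.\<close>
    have "has_outward_normal_derivative u (\<gamma> (- cnj \<zeta>)) (- cnj \<zeta>)" using n by (intro \<gamma>) simp
    then have "((\<lambda>r. u (- cnj (of_real r * \<zeta>))) has_derivative (\<lambda>t. t *\<^sub>R \<gamma> (- cnj \<zeta>))) (at 1 within {0..1})"
      by (simp add: has_outward_normal_derivative_def has_vector_derivative_def)
    from has_derivative_Re[OF this]
    have d2: "((\<lambda>r. Re (u (- cnj (of_real r * \<zeta>)))) has_real_derivative Re (\<gamma> (- cnj \<zeta>))) (at 1 within {0..1})"
      unfolding has_field_derivative_def by (rule has_derivative_eq_rhs) (simp add: fun_eq_iff)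
    have d3: "((\<lambda>r. Re (neumann_barrier (of_real r * \<zeta>))) has_real_derivative \<beta>) (at 1 within {0..1})"
      unfolding \<beta>_def using neumann_barrier_radial_derivative(1)[OF n x] has_field_derivative_at_within by blast
    have n2: "(Im \<zeta>)\<^sup>2 = 1 - (Re \<zeta>)\<^sup>2" using n cmod_power2[of \<zeta>] by simp
    have "7 * Re \<zeta> - 8 * (Re \<zeta>)\<^sup>2 + ((Re \<zeta>)^3 - 3 * Re \<zeta> * (Im \<zeta>)\<^sup>2) = 4 * Re \<zeta> * (1 - Re \<zeta>)\<^sup>2"
      unfolding n2 by (simp add: power2_eq_square power3_eq_cube algebra_simps)
    moreover have "((\<lambda>r. q (of_real r * \<zeta>)) has_real_derivative
        (7 * Re \<zeta> - 8 * (Re \<zeta>)\<^sup>2 + ((Re \<zeta>)^3 - 3 * Re \<zeta> * (Im \<zeta>)\<^sup>2))) (at 1 within {0..1})"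
      unfolding q_def
      by (auto intro!: derivative_eq_intros
           simp: power2_eq_square power3_eq_cube algebra_simps add_divide_distrib diff_divide_distrib)
    ultimately have d4: "((\<lambda>r. q (of_real r * \<zeta>)) has_real_derivative 4 * Re \<zeta> * (1 - Re \<zeta>)\<^sup>2) (at 1 within {0..1})"
      by simp
    have D: "(\<phi> has_real_derivative l) (at 1 within {0..1})"
      unfolding \<phi>_def Ref l_def by (intro DERIV_diff DERIV_cmult d1 d2 d3 d4)
    have "a * 1 \<le> a * \<beta>" using neumann_barrier_radial_derivative(2)[OF n x] ab
      unfolding \<beta>_def by (intro mult_left_mono) auto
    moreover have "0 \<le> b * (4 * Re \<zeta> * (1 - Re \<zeta>)\<^sup>2)" using ab x by (intro mult_nonneg_nonneg) auto
    moreover have "Re (\<gamma> \<zeta>) - Re (\<gamma> (- cnj \<zeta>)) \<le> 2 * \<Gamma>"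
      using \<Gamma>[of \<zeta>] \<Gamma>[of "- cnj \<zeta>"] n abs_Re_le_cmod[of "\<gamma> \<zeta>"] abs_Re_le_cmod[of "\<gamma> (- cnj \<zeta>)"] by simp
    ultimately have "l \<le> 2 * \<Gamma> - a" unfolding l_def by linarith
    then have "l < 0" using e by (simp add: a_def)
    from has_real_derivative_neg_dec_left[OF D this] obtain d where
      d: "d > 0" "\<And>h. 0 < h \<Longrightarrow> 1 - h \<in> {0..1} \<Longrightarrow> h < d \<Longrightarrow> \<phi> 1 < \<phi> (1 - h)" by blast
    define h where "h = min d 1 / 2"
    have h: "0 < h" "h < d" "h < 1" using d(1) by (auto simp: h_def)
    have "of_real (1 - h) * \<zeta> \<in> K" using h x n by (simp add: K_def norm_mult del: of_real_diff)
    from \<zeta>(2)[OF this] have "\<phi> (1 - h) \<le> \<phi> 1" by (simp add: \<phi>_def)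
    then show False using d(2)[of h] h by simp
  qed
  then have "- cnj \<zeta> = \<zeta>" by (simp add: complex_eq_iff)
  moreover have "a * Re (neumann_barrier \<zeta>) \<ge> 0"
    using Re_neumann_barrier_imaginary_axis[OF \<open>Re \<zeta> = 0\<close>] ab by simp
  moreover have "q \<zeta> = 0" using \<open>Re \<zeta> = 0\<close> by (simp add: q_def)
  ultimately have "Re (?f \<zeta>) \<le> 0" unfolding Ref by simp
  then have "Re (?f z) \<le> 0" using \<zeta>(2)[of z] z by (simp add: K_def)
  then have 1: "Re (u z) - Re (u (- cnj z)) \<le> a * Re (neumann_barrier z) + b * q z" unfolding Ref by simp
  define x where "x = Re z"
  have x: "0 \<le> x" "x \<le> 1" using z abs_Re_le_cmod[of z] by (auto simp: x_def)
  have "x ^ 3 \<le> x\<^sup>2" using x by (intro power_decreasing) auto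
  moreover have "0 \<le> x * (Im z)\<^sup>2" using x by simp
  ultimately have q: "q z \<le> 7 * x - 11 / 3 * x\<^sup>2"
    unfolding q_def x_def by (simp add: field_simps)
  have "a * Re (neumann_barrier z) + b * q z \<le> a * (1 + x) + b * (7 * x - 11 / 3 * x\<^sup>2)"
    using ab q Re_neumann_barrier_le[OF z] by (intro add_mono mult_left_mono) (auto simp: x_def)
  also have "\<dots> = 2 * \<Gamma> * (1 + x) + G * (7 * x - 11 / 3 * x\<^sup>2) + e * (2 * (1 + x) + (7 * x - 11 / 3 * x\<^sup>2))"
    by (simp add: a_def b_def algebra_simps)
  also have "e * (2 * (1 + x) + (7 * x - 11 / 3 * x\<^sup>2)) \<le> e * 20"
  proof (rule mult_left_mono)
    have "0 \<le> 11 / 3 * x\<^sup>2" by simp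
    then have "7 * x - 11 / 3 * x\<^sup>2 \<le> 7 * x - 0" by (intro diff_left_mono)
    then show "2 * (1 + x) + (7 * x - 11 / 3 * x\<^sup>2) \<le> 20" using x by argo
  qed (use e in simp)
  finally show "Re (u z - u (- cnj z)) \<le> 2 * \<Gamma> * (1 + Re z) + G * (7 * Re z - 11 / 3 * (Re z)\<^sup>2) + e0"
    using 1 by (simp add: x_def e_def)
qed

section \<open>The Poisson integral\<close>

definition poisson_kernel :: "complex \<Rightarrow> real \<Rightarrow> real" where
  "poisson_kernel z t = (1 - (norm z)\<^sup>2) / (norm (1 - z * cis (- t)))\<^sup>2"

lemma one_minus_mult_cis_nonzero:
  assumes "norm z < 1"
  shows "1 - z * cis t \<noteq> 0"
proof
  assume "1 - z * cis t = 0"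
  then have "norm (z * cis t) = 1" by (metis eq_iff_diff_eq_0 norm_one)
  then show False using assms by (simp add: norm_mult)
qed

text \<open>The Cauchy kernel plus its conjugate minus 1: this is what splits a Poisson integral
  into a holomorphic and an antiholomorphic part.\<close>

lemma poisson_kernel_eq:
  assumes "norm z < 1"
  shows "of_real (poisson_kernel z t) = 1 / (1 - z * cis (- t)) + cnj (1 / (1 - z * cis (- t))) - 1"
proof -
  define a where "a = z * cis (- t)"
  have a: "1 - a \<noteq> 0" using one_minus_mult_cis_nonzero[OF assms] by (simp add: a_def)
  then have a': "cnj (1 - a) \<noteq> 0" by (metis complex_cnj_zero_iff)
  have sq: "(of_real (norm b))\<^sup>2 = b * cnj b" for b :: complex
    by (simp add: complex_norm_square flip: of_real_power)
  have n: "norm z = norm a" by (simp add: a_def norm_mult)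
  have "of_real (poisson_kernel z t) = (1 - a * cnj a) / ((1 - a) * cnj (1 - a))"
    by (simp add: poisson_kernel_def n sq flip: a_def)
  also have "1 - a * cnj a = (1 - a) + cnj (1 - a) - (1 - a) * cnj (1 - a)"
    by (simp add: algebra_simps)
  also have "\<dots> / ((1 - a) * cnj (1 - a)) = 1 / (1 - a) + 1 / cnj (1 - a) - 1"
    using a a' by (simp only: add_divide_distrib diff_divide_distrib) (simp add: divide_simps)
  finally show ?thesis by (simp add: a_def)
qed

lemma poisson_kernel_nonneg: "norm z < 1 \<Longrightarrow> poisson_kernel z t \<ge> 0"
  unfolding poisson_kernel_def by (intro divide_nonneg_nonneg) (auto simp: power_le_one)

lemma has_integral_circle_iff:
  "(f has_contour_integral I) (circlepath 0 1) \<longleftrightarrow>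
    ((\<lambda>t. f (cis t) * \<i> * cis t) has_integral I) {0..2 * pi}"
  using has_contour_integral_part_circlepath_iff[of 0 "2 * pi" f I 0 1] by (simp add: circlepath_def)

lemma contour_integral_circle_div:
  "contour_integral (circlepath 0 1) (\<lambda>\<zeta>. h \<zeta> / \<zeta>) = \<i> * integral {0..2 * pi} (\<lambda>t. h (cis t))"
proof -
  have "contour_integral (circlepath 0 1) (\<lambda>\<zeta>. h \<zeta> / \<zeta>) = integral {0..2 * pi} (\<lambda>t. \<i> * h (cis t))"
    using contour_integral_part_circlepath_eq[of 0 "2 * pi" 0 1 "\<lambda>\<zeta>. h \<zeta> / \<zeta>"] by (simp add: circlepath_def mult.commute)
  then show ?thesis by simp
qed

lemma has_integral_circle_mean:
  assumes "continuous_on (cball 0 1) f" "f holomorphic_on (ball 0 1)"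
  shows "((\<lambda>t. f (cis t)) has_integral 2 * of_real pi * f 0) {0..2 * pi}"
proof -
  have "((\<lambda>u. f u / (u - 0)) has_contour_integral (2 * of_real pi * \<i> * f 0)) (circlepath 0 1)"
    by (rule Cauchy_integral_circlepath[OF assms]) auto
  then have "((\<lambda>t. f (cis t) * \<i>) has_integral (2 * of_real pi * \<i> * f 0)) {0..2 * pi}"
    unfolding has_integral_circle_iff by simp
  from has_integral_mult_left[OF this, of "- \<i>"] show ?thesis by (simp add: mult_ac)
qed

lemma cauchy_kernel_cis:
  assumes "norm z < 1"
  shows "1 / (cis t - z) * \<i> * cis t = \<i> * (1 / (1 - z * cis (- t)))"
proof -
  have "1 - z * cis (- t) = (cis t - z) * cis (- t)" by (simp add: algebra_simps cis_mult)
  then show ?thesis by (simp add: divide_inverse cis_inverse)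
qed

lemma cauchy_transform:
  assumes \<phi>: "continuous_on (sphere 0 1) \<phi>"
  obtains F where "F holomorphic_on ball 0 1"
    and "\<And>z. norm z < 1 \<Longrightarrow> ((\<lambda>t. \<phi> (cis t) / (1 - z * cis (- t))) has_integral 2 * of_real pi * F z) {0..2 * pi}"
proof -
  \<comment> \<open>The exponent 1 brings the integral into the form $\<phi>(u)/(u-w)^k$ of the
    theorem on differentiating Cauchy type integrals, which needs no more than continuity of
    \<open>\<phi>\<close> on the circle.\<close>
  define g where "g = (\<lambda>w. contour_integral (circlepath 0 1) (\<lambda>u. \<phi> u / (u - w) ^ 1))"
  have cont: "continuous_on (path_image (circlepath 0 1)) \<phi>" using \<phi> by simp
  have int: "((\<lambda>u. \<phi> u / (u - w) ^ 1) has_contour_integral g w) (circlepath 0 1)" if w: "w \<in> ball 0 1" for w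
    unfolding g_def
    by (intro has_contour_integral_integral contour_integrable_continuous_circlepath continuous_intros cont)
      (use w in auto)
  have "g holomorphic_on ball 0 1"
    unfolding holomorphic_on_def field_differentiable_def
    using Cauchy_next_derivative_circlepath(2)[OF cont int] has_field_derivative_at_within
    by (metis one_neq_zero)
  then have hol: "(\<lambda>z. g z / (2 * of_real pi * \<i>)) holomorphic_on ball 0 1"
    by (intro holomorphic_intros) auto
  have "((\<lambda>t. \<phi> (cis t) / (1 - z * cis (- t))) has_integral 2 * of_real pi * (g z / (2 * of_real pi * \<i>))) {0..2 * pi}"
    if z: "norm z < 1" for z
  proof -
    have eq: "\<phi> (cis t) / (cis t - z) * \<i> * cis t = \<i> * (\<phi> (cis t) / (1 - z * cis (- t)))" for t
      using arg_cong[OF cauchy_kernel_cis[OF z, of t], of "\<lambda>x. \<phi> (cis t) * x"] by (simp add: mult_ac)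
    have "((\<lambda>t. \<i> * (\<phi> (cis t) / (1 - z * cis (- t)))) has_integral g z) {0..2 * pi}"
      using int[of z] z unfolding has_integral_circle_iff power_one_right eq by simp
    from has_integral_mult_right[OF this, of "- \<i>"] show ?thesis by (simp add: field_simps)
  qed
  with hol show ?thesis by (rule that)
qed

lemma has_integral_poisson_kernel:
  assumes z: "norm z < 1"
  shows "(poisson_kernel z has_integral 2 * pi) {0..2 * pi}"
proof -
  have "((\<lambda>u. 1 / (u - z)) has_contour_integral (2 * of_real pi * \<i> * 1)) (circlepath 0 1)"
    by (rule Cauchy_integral_circlepath) (use z in auto)
  then have I: "((\<lambda>t. 1 / (cis t - z) * \<i> * cis t) has_integral (2 * of_real pi * \<i>)) {0..2 * pi}"
    unfolding has_integral_circle_iff by simp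
  have "((\<lambda>t. - \<i> * (\<i> * (1 / (1 - z * cis (- t))))) has_integral (- \<i> * (2 * of_real pi * \<i>))) {0..2 * pi}"
    using has_integral_mult_right[OF I, of "- \<i>"] unfolding cauchy_kernel_cis[OF z] .
  then have 1: "((\<lambda>t. 1 / (1 - z * cis (- t))) has_integral (2 * of_real pi)) {0..2 * pi}"
    by (simp add: mult_ac)
  have 2: "((\<lambda>t. cnj (1 / (1 - z * cis (- t)))) has_integral cnj (2 * of_real pi)) {0..2 * pi}"
    using has_integral_cnj[THEN iffD2, OF 1] by (simp add: o_def)
  have 3: "((\<lambda>t::real. 1::complex) has_integral (2 * of_real pi)) {0..2 * pi}"
    using has_integral_const_real[of "1::complex" 0 "2 * pi"] by (simp add: scaleR_conv_of_real)
  have "((\<lambda>t. of_real (poisson_kernel z t)) has_integral (2 * of_real pi :: complex)) {0..2 * pi}"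
    using has_integral_diff[OF has_integral_add[OF 1 2] 3] unfolding poisson_kernel_eq[OF z] by simp
  from has_integral_Re[OF this] show ?thesis by simp
qed

lemma continuous_on_poisson_kernel:
  assumes "norm z < 1"
  shows "continuous_on S (poisson_kernel z)"
  unfolding poisson_kernel_def[abs_def]
  by (intro continuous_intros) (use one_minus_mult_cis_nonzero[OF assms] in auto)

lemma continuous_on_circle_param:
  assumes "continuous_on (sphere 0 1) \<phi>"
  shows "continuous_on S (\<lambda>t. \<phi> (cis t))"
  by (rule continuous_on_compose2[OF assms]) (auto intro!: continuous_intros)

lemma poisson_integral_decomposition:
  assumes \<phi>: "continuous_on (sphere 0 1) \<phi>"
  obtains f k where "f holomorphic_on ball 0 1" "k holomorphic_on ball 0 1"
    "\<And>z. norm z < 1 \<Longrightarrow> poisson_integral \<phi> z = f z + cnj (k z)"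
proof -
  obtain F where F: "F holomorphic_on ball 0 1"
    "\<And>z. norm z < 1 \<Longrightarrow> ((\<lambda>t. \<phi> (cis t) / (1 - z * cis (- t))) has_integral 2 * of_real pi * F z) {0..2 * pi}"
    using cauchy_transform[OF \<phi>] by blast
  have "continuous_on (sphere 0 1) (\<lambda>\<zeta>. cnj (\<phi> \<zeta>))" by (intro continuous_intros \<phi>)
  from cauchy_transform[OF this] obtain k where k: "k holomorphic_on ball 0 1"
    "\<And>z. norm z < 1 \<Longrightarrow> ((\<lambda>t. cnj (\<phi> (cis t)) / (1 - z * cis (- t))) has_integral 2 * of_real pi * k z) {0..2 * pi}"
    by blast
  \<comment> \<open>\<open>F 0\<close> is the mean of \<open>\<phi>\<close> and accounts for the
    $-1$ in the kernel identity.\<close>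
  have "poisson_integral \<phi> z = (F z - F 0) + cnj (k z)" if z: "norm z < 1" for z
  proof -
    have 2: "((\<lambda>t. cnj (cnj (\<phi> (cis t)) / (1 - z * cis (- t)))) has_integral cnj (2 * of_real pi * k z)) {0..2 * pi}"
      using has_integral_cnj[THEN iffD2, OF k(2)[OF z]] by (simp add: o_def)
    have 3: "((\<lambda>t. \<phi> (cis t)) has_integral 2 * of_real pi * F 0) {0..2 * pi}"
      using F(2)[of 0] by simp
    have "((\<lambda>t. of_real (poisson_kernel z t) * \<phi> (cis t)) has_integral
       2 * of_real pi * F z + cnj (2 * of_real pi * k z) - 2 * of_real pi * F 0) {0..2 * pi}"
      using has_integral_diff[OF has_integral_add[OF F(2)[OF z] 2] 3] unfolding poisson_kernel_eq[OF z]
      by (simp add: algebra_simps add_divide_distrib)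
    then show ?thesis unfolding poisson_integral_def poisson_kernel_def[symmetric]
      by (simp add: integral_unique field_simps)
  qed
  then show ?thesis using F(1) k(1) by (intro that[of "\<lambda>z. F z - F 0" k] holomorphic_intros) auto
qed

text \<open>The kernel has mean 1. The two-term majorant serves two purposes: with $C = 0$ it gives
  the sup bound, and near the boundary \<open>\<epsilon>\<close> covers the nearby arc and
  \<open>C\<close> the distant one.\<close>

lemma norm_poisson_integral_diff_le:
  assumes \<phi>: "continuous_on (sphere 0 1) \<phi>" and z: "norm z < 1"
    and le: "\<And>t. poisson_kernel z t * norm (\<phi> (cis t) - a) \<le> \<epsilon> * poisson_kernel z t + C"
  shows "norm (poisson_integral \<phi> z - a) \<le> \<epsilon> + C"
proof -
  have I: "(\<lambda>t. of_real (poisson_kernel z t) * \<phi> (cis t)) integrable_on {0..2 * pi}"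
    by (intro integrable_continuous_real continuous_intros continuous_on_poisson_kernel z continuous_on_circle_param \<phi>)
  have K: "((\<lambda>t. of_real (poisson_kernel z t) * a) has_integral 2 * of_real pi * a) {0..2 * pi}"
    using has_integral_mult_left[OF has_integral_of_real[OF has_integral_poisson_kernel[OF z], where 'b=complex], of a] by simp
  have D: "((\<lambda>t. of_real (poisson_kernel z t) * \<phi> (cis t) - of_real (poisson_kernel z t) * a) has_integral
     2 * of_real pi * poisson_integral \<phi> z - 2 * of_real pi * a) {0..2 * pi}"
    using has_integral_diff[OF integrable_integral[OF I] K]
    unfolding poisson_integral_def poisson_kernel_def[symmetric] by simp
  have R: "((\<lambda>t. \<epsilon> * poisson_kernel z t + C) has_integral \<epsilon> * (2 * pi) + (2 * pi) * C) {0..2 * pi}"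
    using has_integral_add[OF has_integral_mult_right[OF has_integral_poisson_kernel[OF z], of \<epsilon>]
      has_integral_const_real[of C 0 "2 * pi"]] by simp
  have "norm (integral {0..2 * pi} (\<lambda>t. of_real (poisson_kernel z t) * \<phi> (cis t) - of_real (poisson_kernel z t) * a))
    \<le> integral {0..2 * pi} (\<lambda>t. \<epsilon> * poisson_kernel z t + C)"
  proof (rule Henstock_Kurzweil_Integration.integral_norm_bound_integral)
    fix t
    have "norm (of_real (poisson_kernel z t) * \<phi> (cis t) - of_real (poisson_kernel z t) * a) =
      poisson_kernel z t * norm (\<phi> (cis t) - a)"
      using poisson_kernel_nonneg[OF z, of t] by (simp add: norm_mult flip: right_diff_distrib)
    then show "norm (of_real (poisson_kernel z t) * \<phi> (cis t) - of_real (poisson_kernel z t) * a)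
      \<le> \<epsilon> * poisson_kernel z t + C" using le by simp
  qed (use D R in blast)+
  also have "\<dots> = (2 * pi) * (\<epsilon> + C)" using integral_unique[OF R] by (simp add: algebra_simps)
  also have "integral {0..2 * pi} (\<lambda>t. of_real (poisson_kernel z t) * \<phi> (cis t) - of_real (poisson_kernel z t) * a)
    = (2 * pi) * (poisson_integral \<phi> z - a)" using integral_unique[OF D] by (simp add: algebra_simps)
  also have "norm \<dots> = (2 * pi) * norm (poisson_integral \<phi> z - a)" by (simp add: norm_mult)
  finally show ?thesis by simp
qed

lemma norm_poisson_integral_le:
  assumes \<phi>: "continuous_on (sphere 0 1) \<phi>" and z: "norm z < 1"
    and le: "\<And>\<zeta>. norm \<zeta> = 1 \<Longrightarrow> norm (\<phi> \<zeta>) \<le> B"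
  shows "norm (poisson_integral \<phi> z) \<le> B"
  using norm_poisson_integral_diff_le[OF \<phi> z, of 0 B 0]
    mult_left_mono[OF le poisson_kernel_nonneg[OF z], of "cis _"] by (simp add: mult.commute)

lemma poisson_kernel_le:
  assumes "norm z < 1" "norm \<zeta>0 = 1" "d > 0" "dist z \<zeta>0 < d / 2" "dist (cis t) \<zeta>0 \<ge> d"
  shows "poisson_kernel z t \<le> 4 / d\<^sup>2 * (1 - (norm z)\<^sup>2)"
proof -
  have "dist (cis t) \<zeta>0 \<le> dist (cis t) z + dist z \<zeta>0" by (rule dist_triangle)
  then have "d / 2 \<le> norm (cis t - z)" using assms by (simp add: dist_norm)
  also have "norm (cis t - z) = norm ((cis t - z) * cis (- t))" by (simp add: norm_mult)
  also have "(cis t - z) * cis (- t) = 1 - z * cis (- t)" by (simp add: algebra_simps cis_mult)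
  finally have "(d / 2)\<^sup>2 \<le> (norm (1 - z * cis (- t)))\<^sup>2" using assms by (intro power_mono) auto
  then have "poisson_kernel z t \<le> (1 - (norm z)\<^sup>2) / (d / 2)\<^sup>2"
    unfolding poisson_kernel_def
  proof (rule divide_left_mono)
    have "0 < (d / 2)\<^sup>2" using assms by simp
    then show "0 < (norm (1 - z * cis (- t)))\<^sup>2 * (d / 2)\<^sup>2"
      using \<open>(d / 2)\<^sup>2 \<le> _\<close> by (intro mult_pos_pos) linarith+
  qed (use assms in \<open>auto simp: power_le_one\<close>)
  then show ?thesis by (simp add: power_divide field_simps)
qed

lemma poisson_integral_near_boundary:
  assumes \<phi>: "continuous_on (sphere 0 1) \<phi>" and \<zeta>0: "norm \<zeta>0 = 1" and e: "e > 0"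
  shows "\<exists>\<delta>>0. \<forall>z. norm z < 1 \<and> dist z \<zeta>0 < \<delta> \<longrightarrow> norm (poisson_integral \<phi> z - \<phi> \<zeta>0) < e"
proof -
  have "bounded (\<phi> ` sphere 0 1)"
    by (intro compact_imp_bounded compact_continuous_image \<phi> compact_sphere)
  then obtain B where B: "B > 0" "\<And>\<zeta>. norm \<zeta> = 1 \<Longrightarrow> norm (\<phi> \<zeta>) \<le> B"
    unfolding bounded_pos by auto
  obtain d where d: "d > 0" "\<And>\<zeta>. norm \<zeta> = 1 \<Longrightarrow> dist \<zeta> \<zeta>0 < d \<Longrightarrow> norm (\<phi> \<zeta> - \<phi> \<zeta>0) < e / 2"
    using \<phi> \<zeta>0 e unfolding continuous_on_iff by (metis dist_norm half_gt_zero mem_sphere_0)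
  define M where "M = 2 * B * (4 / d\<^sup>2)"
  have M: "M > 0" using B d by (simp add: M_def)
  \<comment> \<open>The value $d/2$ makes the kernel small on the distant arc, and $e/(4M)$ gives
    $M(1-|z|^2) \<le> 2M(1-|z|) < e/2$.\<close>
  define \<delta> where "\<delta> = min (d / 2) (e / (4 * M))"
  have \<delta>: "\<delta> > 0" using d e M by (simp add: \<delta>_def)
  have "norm (poisson_integral \<phi> z - \<phi> \<zeta>0) < e" if z: "norm z < 1" "dist z \<zeta>0 < \<delta>" for z
  proof -
    have "norm (poisson_integral \<phi> z - \<phi> \<zeta>0) \<le> e / 2 + M * (1 - (norm z)\<^sup>2)"
    proof (rule norm_poisson_integral_diff_le[OF \<phi> z(1)])
      fix t
      have nn: "0 \<le> poisson_kernel z t" "0 \<le> M * (1 - (norm z)\<^sup>2)"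
        using poisson_kernel_nonneg[OF z(1)] M z by (auto simp: power_le_one)
      show "poisson_kernel z t * norm (\<phi> (cis t) - \<phi> \<zeta>0) \<le> e / 2 * poisson_kernel z t + M * (1 - (norm z)\<^sup>2)"
      proof (cases "dist (cis t) \<zeta>0 < d")
        case True
        then have "poisson_kernel z t * norm (\<phi> (cis t) - \<phi> \<zeta>0) \<le> poisson_kernel z t * (e / 2)"
          using d(2)[of "cis t"] nn by (intro mult_left_mono) auto
        then show ?thesis using nn by (simp add: mult.commute)
      next
        case False
        have "norm (\<phi> (cis t) - \<phi> \<zeta>0) \<le> 2 * B"
          using norm_triangle_ineq4[of "\<phi> (cis t)" "\<phi> \<zeta>0"] B(2)[of "cis t"] B(2)[OF \<zeta>0] by simp
        moreover have "poisson_kernel z t \<le> 4 / d\<^sup>2 * (1 - (norm z)\<^sup>2)"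
          by (rule poisson_kernel_le[OF z(1) \<zeta>0 d(1)]) (use z False in \<open>auto simp: \<delta>_def\<close>)
        ultimately have "poisson_kernel z t * norm (\<phi> (cis t) - \<phi> \<zeta>0) \<le> (4 / d\<^sup>2 * (1 - (norm z)\<^sup>2)) * (2 * B)"
          using nn z by (intro mult_mono) (auto simp: power_le_one)
        also have "\<dots> = M * (1 - (norm z)\<^sup>2)" by (simp add: M_def)
        finally show ?thesis using mult_nonneg_nonneg[OF _ nn(1), of "e / 2"] e by simp
      qed
    qed
    also have "\<dots> < e"
    proof -
      have "1 - norm z \<le> norm (\<zeta>0 - z)" using norm_triangle_ineq2[of \<zeta>0 z] \<zeta>0 by simp
      then have "1 - norm z < e / (4 * M)" using z(2) by (simp add: \<delta>_def dist_norm norm_minus_commute)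
      moreover have "1 - (norm z)\<^sup>2 = (1 - norm z) * (1 + norm z)" by (simp add: power2_eq_square algebra_simps)
      moreover have "(1 - norm z) * (1 + norm z) \<le> (1 - norm z) * 2" using z by (intro mult_left_mono) auto
      ultimately have "1 - (norm z)\<^sup>2 < e / (2 * M)" by simp
      then have "M * (1 - (norm z)\<^sup>2) < M * (e / (2 * M))" using M by (rule mult_strict_left_mono)
      then show ?thesis using M by simp
    qed
    finally show ?thesis .
  qed
  then show ?thesis using \<delta> by blast
qed

lemma continuous_on_poisson_extension:
  assumes \<phi>: "continuous_on (sphere 0 1) \<phi>"
  shows "continuous_on (cball 0 1) (\<lambda>z. if norm z < 1 then poisson_integral \<phi> z else \<phi> z)"
    (is "continuous_on _ ?P")
proof -
  obtain f k where fk: "f holomorphic_on ball 0 1" "k holomorphic_on ball 0 1"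
    "\<And>z. norm z < 1 \<Longrightarrow> poisson_integral \<phi> z = f z + cnj (k z)"
    using poisson_integral_decomposition[OF \<phi>] by blast
  have "continuous_on (ball 0 1) (\<lambda>z. f z + cnj (k z))"
    by (intro continuous_intros holomorphic_on_imp_continuous_on fk)
  then have "continuous_on (ball 0 1) ?P"
    by (rule continuous_on_eq) (simp add: fk(3))
  then have inner: "isCont ?P z" if "norm z < 1" for z
    using that by (simp add: continuous_on_eq_continuous_at)
  have "continuous (at z within cball 0 1) ?P" if z: "z \<in> cball 0 1" for z
  proof (cases "norm z < 1")
    case True
    then show ?thesis using inner continuous_at_imp_continuous_at_within by blast
  next
    case False
    then have z1: "norm z = 1" using z by simp
    show ?thesis unfolding continuous_within_eps_delta
    proof (intro allI impI)
      fix e :: real assume e: "e > 0"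
      obtain d1 where d1: "d1 > 0" "\<And>x. norm x < 1 \<Longrightarrow> dist x z < d1 \<Longrightarrow> norm (poisson_integral \<phi> x - \<phi> z) < e"
        using poisson_integral_near_boundary[OF \<phi> z1 e] by blast
      obtain d2 where d2: "d2 > 0" "\<And>x. norm x = 1 \<Longrightarrow> dist x z < d2 \<Longrightarrow> dist (\<phi> x) (\<phi> z) < e"
        using \<phi> z1 e unfolding continuous_on_iff by (metis mem_sphere_0)
      show "\<exists>d>0. \<forall>x'\<in>cball 0 1. dist x' z < d \<longrightarrow> dist (?P x') (?P z) < e"
        using d1 d2 z1 by (intro exI[of _ "min d1 d2"]) (auto simp: dist_norm)
    qed
  qed
  then show ?thesis by (simp add: continuous_on_eq_continuous_within)
qed

section \<open>The gradient of a bounded harmonic function\<close>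

text \<open>The Schwarz lemma for $T(E(m))$: the Moebius map \<open>m\<close> takes 0 to
  \<open>z\<close> with derivative $1-|z|^2$, and the Cayley transform \<open>T\<close> takes the
  right half plane into the disc and \<open>E z\<close> to 0, with derivative $1/(2 Re E(z))$
  there.\<close>

lemma schwarz_pick_half_plane:
  assumes E: "E holomorphic_on ball 0 1" "\<And>z. norm z < 1 \<Longrightarrow> Re (E z) > 0" and z: "norm z < 1"
  shows "norm (deriv E z) * (1 - (norm z)\<^sup>2) \<le> 2 * Re (E z)"
proof -
  define m where "m = Moebius_function 0 (- z)"
  define T where "T = (\<lambda>e. (e - E z) / (e + cnj (E z)))"
  have m: "m holomorphic_on ball 0 1" "\<And>\<zeta>. norm \<zeta> < 1 \<Longrightarrow> norm (m \<zeta>) < 1"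
    unfolding m_def using z by (auto intro: Moebius_function_holomorphic Moebius_function_norm_lt_1)
  have m0: "m 0 = z" by (simp add: m_def Moebius_function_of_zero)
  have nz: "e + cnj (E z) \<noteq> 0" if "Re e > 0" for e
    using that E(2)[OF z] by (auto simp: complex_eq_iff)
  have T1: "norm (T e) < 1" if e: "Re e > 0" for e
  proof -
    have "(norm (e + cnj (E z)))\<^sup>2 - (norm (e - E z))\<^sup>2 = 4 * (Re e * Re (E z))"
      unfolding cmod_power2 by (simp add: power2_eq_square algebra_simps)
    moreover have "0 < Re e * Re (E z)" using e E(2)[OF z] by simp
    ultimately have "(norm (e - E z))\<^sup>2 < (norm (e + cnj (E z)))\<^sup>2" by linarith
    then have "norm (e - E z) < norm (e + cnj (E z))" by (rule power_less_imp_less_base) simp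
    then show ?thesis using nz[OF e] by (simp add: T_def norm_divide)
  qed
  define \<Phi> where "\<Phi> = (\<lambda>\<zeta>. T (E (m \<zeta>)))"
  have "(\<lambda>\<zeta>. E (m \<zeta>)) holomorphic_on ball 0 1"
    using holomorphic_on_compose_gen[OF m(1) E(1)] m(2) by (simp add: o_def image_subset_iff)
  then have hol: "\<Phi> holomorphic_on ball 0 1" unfolding \<Phi>_def T_def
    by (intro holomorphic_intros) (use nz E(2) m(2) in auto)
  have "norm (deriv \<Phi> 0) \<le> 1"
    by (rule Schwarz_Lemma(2)[OF hol, of 0]) (auto simp: \<Phi>_def T_def m0[unfolded T_def] intro!: T1[unfolded T_def] E m(2))
  moreover have "(\<Phi> has_field_derivative (1 / (2 * Re (E z)) * (deriv E z * (1 - (norm z)\<^sup>2)))) (at 0)"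
  proof -
    have "((\<lambda>\<zeta>. (\<zeta> + z) / (1 + cnj z * \<zeta>)) has_field_derivative 1 - cnj z * z) (at 0)"
      by (auto intro!: derivative_eq_intros)
    also have "(\<lambda>\<zeta>. (\<zeta> + z) / (1 + cnj z * \<zeta>)) = m" by (simp add: m_def Moebius_function_simple fun_eq_iff)
    finally have 1: "(m has_field_derivative (1 - (norm z)\<^sup>2)) (at 0)"
      by (simp add: complex_norm_square mult.commute del: of_real_power)
    have 2: "(E has_field_derivative deriv E z) (at (m 0))"
      unfolding m0 using E(1) z by (intro holomorphic_derivI[of _ "ball 0 1"]) auto
    have 3: "(T has_field_derivative 1 / (2 * Re (E z))) (at (E (m 0)))"
    proof -
      have "E z + cnj (E z) = 2 * Re (E z)" by (rule complex_add_cnj)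
      then show ?thesis unfolding T_def m0 using nz[OF E(2)[OF z]] E(2)[OF z]
        by (auto intro!: derivative_eq_intros simp: field_simps)
    qed
    show ?thesis unfolding \<Phi>_def using DERIV_chain2[OF 3 DERIV_chain2[OF 2 1]] by simp
  qed
  ultimately have "norm (1 / (2 * Re (E z)) * (deriv E z * (1 - (norm z)\<^sup>2))) \<le> 1"
    using DERIV_imp_deriv by metis
  also have "norm (1 / (2 * Re (E z)) * (deriv E z * (1 - (norm z)\<^sup>2))) =
    norm (deriv E z) * (1 - (norm z)\<^sup>2) / (2 * Re (E z))"
  proof -
    have "norm (1 - (of_real (norm z))\<^sup>2 :: complex) = 1 - (norm z)\<^sup>2"
      using z norm_of_real[of "1 - (norm z)\<^sup>2", where 'a=complex] by (simp add: power_le_one)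
    then show ?thesis using E(2)[OF z] by (simp add: norm_mult norm_divide)
  qed
  finally show ?thesis using E(2)[OF z] by (simp add: field_simps)
qed

text \<open>With $cM = pi/2$ the function $exp(icF)$ takes values in the right half plane. Its
  derivative contains the factor $|E(z)|$, which cancels against $Re E(z) \<le> |E(z)|$ and leaves
  $2/c = 4M/pi$.\<close>

lemma norm_deriv_le_of_bounded_Re:
  assumes F: "F holomorphic_on ball 0 1" "\<And>z. norm z < 1 \<Longrightarrow> \<bar>Re (F z)\<bar> < M" and z: "norm z < 1"
  shows "norm (deriv F z) * (1 - (norm z)\<^sup>2) \<le> 4 / pi * M"
proof -
  have M: "M > 0" using F(2)[OF z] by simp
  define c where "c = pi / (2 * M)"
  have c: "c > 0" using M by (simp add: c_def)
  define E where "E = (\<lambda>z. exp (\<i> * of_real c * F z))"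
  have hol: "E holomorphic_on ball 0 1" unfolding E_def by (intro holomorphic_intros F)
  have pos: "Re (E \<zeta>) > 0" if "norm \<zeta> < 1" for \<zeta>
  proof -
    have "\<bar>c * Re (F \<zeta>)\<bar> < c * M" using F(2)[OF that] c by (simp add: abs_mult)
    then have "\<bar>c * Re (F \<zeta>)\<bar> < pi / 2" using M by (simp add: c_def)
    then have "cos (c * Re (F \<zeta>)) > 0" by (intro cos_gt_zero_pi) linarith+
    then show ?thesis by (simp add: E_def Re_exp)
  qed
  have "deriv E z = \<i> * of_real c * deriv F z * E z"
  proof (rule DERIV_imp_deriv)
    have "(F has_field_derivative deriv F z) (at z)" using F(1) z by (intro holomorphic_derivI[of _ "ball 0 1"]) auto
    then show "(E has_field_derivative \<i> * of_real c * deriv F z * E z) (at z)"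
      unfolding E_def by (auto intro!: derivative_eq_intros)
  qed
  then have "c * norm (deriv F z) * norm (E z) * (1 - (norm z)\<^sup>2) \<le> 2 * Re (E z)"
    using schwarz_pick_half_plane[OF hol pos z] c by (simp add: norm_mult)
  also have "\<dots> \<le> 2 * norm (E z)" using complex_Re_le_cmod by simp
  finally have "norm (E z) * (c * norm (deriv F z) * (1 - (norm z)\<^sup>2)) \<le> norm (E z) * 2"
    by (simp add: mult_ac)
  then have "c * norm (deriv F z) * (1 - (norm z)\<^sup>2) \<le> 2" by (simp add: E_def)
  then show ?thesis using M by (simp add: c_def field_simps)
qed

text \<open>\<open>a\<close> and \<open>cnj a\<close> turn \<open>x\<close> and \<open>y\<close> in
  opposite senses, so half the difference of the arguments aligns them.\<close>

lemma exists_aligning_rotation: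
  "\<exists>a::complex. norm a = 1 \<and> norm (a * x + cnj a * y) = norm x + norm y"
proof -
  define a where "a = cis ((Arg y - Arg x) / 2)"
  have x: "x = norm x * cis (Arg x)" and y: "y = norm y * cis (Arg y)"
    using rcis_cmod_Arg[of x] rcis_cmod_Arg[of y] by (simp_all add: rcis_def)
  have ax: "a * cis (Arg x) = cis ((Arg x + Arg y) / 2)" and ay: "cnj a * cis (Arg y) = cis ((Arg x + Arg y) / 2)"
    by (simp_all add: a_def cis_mult cis_cnj field_simps)
  have "a * x = of_real (norm x) * (a * cis (Arg x))" by (subst x) (simp only: mult.left_commute)
  moreover have "cnj a * y = of_real (norm y) * (cnj a * cis (Arg y))" by (subst y) (simp only: mult.left_commute)
  ultimately have "a * x + cnj a * y = of_real (norm x + norm y) * cis ((Arg x + Arg y) / 2)"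
    unfolding ax ay by (simp add: distrib_right)
  then have "norm (a * x + cnj a * y) = norm x + norm y" by (simp add: norm_mult del: of_real_add)
  then show ?thesis by (intro exI[of _ a]) (simp add: a_def)
qed

text \<open>Complex-valued harmonic functions reduce to holomorphic ones with bounded real part:
  $a(f + cnj k)$ and $af + (cnj a)k$ have the same real part, and for the aligning \<open>a\<close>
  the derivative of the latter has modulus $|f'| + |k'|$.\<close>

lemma harmonic_gradient_le:
  assumes fk: "f holomorphic_on ball 0 1" "k holomorphic_on ball 0 1"
    and M: "\<And>z. norm z < 1 \<Longrightarrow> norm (f z + cnj (k z)) \<le> M" and z: "norm z < 1"
  shows "norm (deriv f z) + norm (deriv k z) \<le> 4 / pi * M * (1 / (1 - (norm z)\<^sup>2))"
proof -
  have z2: "1 - (norm z)\<^sup>2 > 0" using z by (simp add: abs_square_less_1)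
  obtain a where a: "norm a = 1" "norm (a * deriv f z + cnj a * deriv k z) = norm (deriv f z) + norm (deriv k z)"
    using exists_aligning_rotation by blast
  define F where "F = (\<lambda>z. a * f z + cnj a * k z)"
  have hol: "F holomorphic_on ball 0 1" unfolding F_def by (intro holomorphic_intros fk)
  have "deriv F z = a * deriv f z + cnj a * deriv k z"
    unfolding F_def by (rule DERIV_imp_deriv)
      (use z in \<open>auto intro!: DERIV_add DERIV_cmult holomorphic_derivI[of _ "ball 0 1"] fk\<close>)
  then have n: "norm (deriv F z) = norm (deriv f z) + norm (deriv k z)" using a by simp
  have "norm (deriv F z) * (1 - (norm z)\<^sup>2) \<le> 4 / pi * M"
  proof (rule field_le_epsilon)
    fix e :: real assume e: "e > 0"
    \<comment> \<open>The strip estimate asks for a strict bound; the surplus is scaled so that the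
      factor $4/pi$ turns it into \<open>e\<close>.\<close>
    have "norm (deriv F z) * (1 - (norm z)\<^sup>2) \<le> 4 / pi * (M + e * pi / 4)"
    proof (rule norm_deriv_le_of_bounded_Re[OF hol _ z])
      fix \<zeta> :: complex assume \<zeta>: "norm \<zeta> < 1"
      have "Re (F \<zeta>) = Re (a * (f \<zeta> + cnj (k \<zeta>)))" by (simp add: F_def algebra_simps)
      then have "\<bar>Re (F \<zeta>)\<bar> \<le> norm (f \<zeta> + cnj (k \<zeta>))"
        using abs_Re_le_cmod[of "a * (f \<zeta> + cnj (k \<zeta>))"] a by (simp add: norm_mult)
      also have "\<dots> < M + e * pi / 4" using M[OF \<zeta>] e by (simp add: le_less_trans)
      finally show "\<bar>Re (F \<zeta>)\<bar> < M + e * pi / 4" .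
    qed
    also have "\<dots> = 4 / pi * M + e" by (simp add: field_simps)
    finally show "norm (deriv F z) * (1 - (norm z)\<^sup>2) \<le> 4 / pi * M + e" .
  qed
  then show ?thesis unfolding n using z2 by (simp add: field_simps)
qed

lemma harmonic_has_derivative:
  assumes "f holomorphic_on ball 0 1" "k holomorphic_on ball 0 1" "norm z < 1"
  shows "((\<lambda>z. f z + cnj (k z)) has_derivative (\<lambda>h. deriv f z * h + cnj (deriv k z * h))) (at z)"
proof -
  have "(f has_derivative (\<lambda>h. deriv f z * h)) (at z)" "(k has_derivative (\<lambda>h. deriv k z * h)) (at z)"
    using assms holomorphic_derivI[of _ "ball 0 1" z] has_field_derivative_def[of _ _ "at z"] by auto
  then show ?thesis by (intro has_derivative_add has_derivative_cnj)
qed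

section \<open>The mean over a circle and the gradient estimate\<close>

text \<open>\<open>z\<close> and \<open>cis \<theta> * z\<close> are mirror images in a diameter at
  distance $|z| sin(\<theta>/2)$ from both. The rotation by \<open>\<omega>\<close> takes the
  imaginary axis to that diameter, and \<open>p\<close> and \<open>- cnj p\<close> to the two
  points.\<close>

lemma Re_neumann_rotation_le:
  assumes u: "continuous_on (cball 0 1) u" "has_wirtinger_laplacian u g (ball 0 1)"
    and G: "\<And>z. norm z < 1 \<Longrightarrow> norm (g z) \<le> G"
    and \<gamma>: "\<And>\<zeta>. norm \<zeta> = 1 \<Longrightarrow> has_outward_normal_derivative u (\<gamma> \<zeta>) \<zeta>"
    and \<Gamma>: "\<And>\<zeta>. norm \<zeta> = 1 \<Longrightarrow> norm (\<gamma> \<zeta>) \<le> \<Gamma>"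
    and z: "norm z \<le> 1" and a: "norm a = 1" and \<theta>: "0 \<le> \<theta>" "\<theta> \<le> 2 * pi"
  shows "Re (a * (u z - u (cis \<theta> * z))) \<le> 2 * \<Gamma> * (1 + norm z * sin (\<theta> / 2))
    + G * (7 * (norm z * sin (\<theta> / 2)) - 11 / 3 * (norm z * sin (\<theta> / 2))\<^sup>2)"
proof -
  define p where "p = of_real (norm z) * cis (pi / 2 - \<theta> / 2)"
  define \<omega> where "\<omega> = cis (Arg z - pi / 2 + \<theta> / 2)"
  have \<omega>: "norm \<omega> = 1" "\<omega> * cnj \<omega> = 1" by (simp_all add: \<omega>_def cis_cnj cis_mult)
  have p: "norm p = norm z" "Re p = norm z * sin (\<theta> / 2)"
    by (simp_all add: p_def norm_mult sin_cos_eq)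
  have "sin (\<theta> / 2) \<ge> 0" using \<theta> by (intro sin_ge_zero) auto
  then have Rep: "Re p \<ge> 0" using p by simp
  have "\<omega> * p = of_real (norm z) * cis (Arg z)" by (simp add: \<omega>_def p_def cis_mult mult.left_commute)
  then have \<omega>p: "\<omega> * p = z" using rcis_cmod_Arg[of z] by (simp add: rcis_def)
  have "- cnj (cis (pi / 2 - \<theta> / 2)) = cis \<theta> * cis (pi / 2 - \<theta> / 2)"
    by (simp add: cis_mult complex_eq_iff cos_add sin_add cos_diff sin_diff)
  moreover have "- cnj p = of_real (norm z) * (- cnj (cis (pi / 2 - \<theta> / 2)))" by (simp add: p_def)
  ultimately have "- cnj p = cis \<theta> * p" by (simp only: p_def mult.left_commute)
  then have \<omega>p': "\<omega> * (- cnj p) = cis \<theta> * z" using \<omega>p by (simp add: mult.left_commute)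
  let ?u = "\<lambda>\<zeta>. a * u (\<omega> * \<zeta> + 0) + 0 * 0" and ?g = "\<lambda>\<zeta>. a * (\<omega> * cnj \<omega> * g (\<omega> * \<zeta> + 0)) + 0 * 0"
  have "Re (?u p - ?u (- cnj p)) \<le> 2 * \<Gamma> * (1 + Re p) + G * (7 * Re p - 11 / 3 * (Re p)\<^sup>2)"
  proof (rule Re_neumann_reflection_le[where g="?g" and \<gamma>="\<lambda>\<zeta>. a * \<gamma> (\<omega> * \<zeta>)"])
    show "continuous_on (cball 0 1) ?u"
      by (intro continuous_intros continuous_on_compose2[OF u(1)]) (auto simp: norm_mult \<omega>)
    show "has_wirtinger_laplacian ?u ?g (ball 0 1)"
      by (intro has_wirtinger_laplacian_lincomb has_wirtinger_laplacian_affine[OF u(2)] has_wirtinger_laplacian_holomorphic)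
        (auto simp: norm_mult \<omega>)
    fix \<zeta> :: complex assume \<zeta>: "norm \<zeta> = 1"
    have "has_outward_normal_derivative u (\<gamma> (\<omega> * \<zeta>)) (\<omega> * \<zeta>)" using \<zeta> \<omega> by (intro \<gamma>) (simp add: norm_mult)
    then have "((\<lambda>r. a * u (of_real r * (\<omega> * \<zeta>))) has_vector_derivative a * \<gamma> (\<omega> * \<zeta>)) (at 1 within {0..1})"
      unfolding has_outward_normal_derivative_def by (rule has_vector_derivative_mult_right)
    then show "has_outward_normal_derivative ?u (a * \<gamma> (\<omega> * \<zeta>)) \<zeta>"
      by (simp add: has_outward_normal_derivative_def mult.left_commute)
    show "norm (a * \<gamma> (\<omega> * \<zeta>)) \<le> \<Gamma>" using \<Gamma>[of "\<omega> * \<zeta>"] \<zeta> \<omega> a by (simp add: norm_mult)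
  qed (use G \<omega> a z p Rep in \<open>auto simp: norm_mult\<close>)
  then show ?thesis using \<omega>p \<omega>p' by (simp add: p(2) algebra_simps)
qed

lemma has_integral_sin_half: "((\<lambda>t. sin (t / 2)) has_integral 4) {0..2 * pi}"
proof -
  have "((\<lambda>t. sin (t / 2)) has_integral (- 2 * cos (2 * pi / 2)) - (- 2 * cos (0 / 2))) {0..2 * pi}"
    by (rule fundamental_theorem_of_calculus)
      (auto intro!: derivative_eq_intros simp flip: has_real_derivative_iff_has_vector_derivative)
  then show ?thesis by simp
qed

lemma has_integral_sin_half_squared: "((\<lambda>t. (sin (t / 2))\<^sup>2) has_integral pi) {0..2 * pi}"
proof -
  have eq: "(sin (t / 2))\<^sup>2 = (1 - cos t) / 2" for t :: real
    using cos_double_sin[of "t / 2"] by simp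
  have "((\<lambda>t. (1 - cos t) / 2) has_integral ((2 * pi - sin (2 * pi)) / 2) - ((0 - sin 0) / 2)) {0..2 * pi}"
    by (rule fundamental_theorem_of_calculus)
      (auto intro!: derivative_eq_intros simp flip: has_real_derivative_iff_has_vector_derivative)
  then show ?thesis unfolding eq by simp
qed

lemma circle_rotation_integrable:
  fixes u :: "complex \<Rightarrow> complex"
  assumes "continuous_on (cball 0 1) u" "norm z \<le> 1"
  shows "(\<lambda>\<theta>. u (cis \<theta> * z)) integrable_on {0..2 * pi}"
  by (rule integrable_continuous_real, rule continuous_on_compose2[OF assms(1)])
    (use assms(2) in \<open>auto intro!: continuous_intros simp: norm_mult\<close>)

text \<open>The rotation estimate integrated over \<open>\<theta>\<close>, with the unimodular
  factor \<open>a\<close> fixed first so that it can be taken out of the integral. The integrals 4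
  and pi of $sin(\<theta>/2)$ and its square produce the coefficients.\<close>

lemma norm_diff_circle_mean_le:
  assumes u: "continuous_on (cball 0 1) u" "has_wirtinger_laplacian u g (ball 0 1)"
    and G: "\<And>z. norm z < 1 \<Longrightarrow> norm (g z) \<le> G"
    and \<gamma>: "\<And>\<zeta>. norm \<zeta> = 1 \<Longrightarrow> has_outward_normal_derivative u (\<gamma> \<zeta>) \<zeta>"
    and \<Gamma>: "\<And>\<zeta>. norm \<zeta> = 1 \<Longrightarrow> norm (\<gamma> \<zeta>) \<le> \<Gamma>"
    and z: "norm z \<le> 1"
  shows "norm (2 * of_real pi * u z - integral {0..2 * pi} (\<lambda>\<theta>. u (cis \<theta> * z))) \<le>
    2 * \<Gamma> * (2 * pi + 4 * norm z) + G * (28 * norm z - 11 / 3 * pi * (norm z)\<^sup>2)"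
proof (rule norm_le_by_rotation)
  fix a :: complex assume a: "norm a = 1"
  have const: "((\<lambda>\<theta>. u z) has_integral 2 * of_real pi * u z) {0..2 * pi}"
    using has_integral_const_real[of "u z" 0 "2 * pi"] by (simp add: scaleR_conv_of_real)
  have 1: "((\<lambda>\<theta>. Re (a * (u z - u (cis \<theta> * z)))) has_integral
      Re (a * (2 * of_real pi * u z - integral {0..2 * pi} (\<lambda>\<theta>. u (cis \<theta> * z))))) {0..2 * pi}"
    by (intro has_integral_Re has_integral_mult_right has_integral_diff const
        integrable_integral circle_rotation_integrable u z)
  have "((\<lambda>\<theta>. 2 * \<Gamma> * (1 + norm z * sin (\<theta> / 2))
      + G * (7 * (norm z * sin (\<theta> / 2)) - 11 / 3 * ((norm z)\<^sup>2 * (sin (\<theta> / 2))\<^sup>2))) has_integral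
     2 * \<Gamma> * (2 * pi + norm z * 4) + G * (7 * (norm z * 4) - 11 / 3 * ((norm z)\<^sup>2 * pi))) {0..2 * pi}"
    using has_integral_const_real[of "1::real" 0 "2 * pi"]
    by (intro has_integral_add has_integral_diff has_integral_mult_right has_integral_sin_half
       has_integral_sin_half_squared) simp
  then have 2: "((\<lambda>\<theta>. 2 * \<Gamma> * (1 + norm z * sin (\<theta> / 2))
      + G * (7 * (norm z * sin (\<theta> / 2)) - 11 / 3 * (norm z * sin (\<theta> / 2))\<^sup>2)) has_integral
     2 * \<Gamma> * (2 * pi + 4 * norm z) + G * (28 * norm z - 11 / 3 * pi * (norm z)\<^sup>2)) {0..2 * pi}"
    by (simp add: power_mult_distrib mult_ac)
  show "Re (a * (2 * of_real pi * u z - integral {0..2 * pi} (\<lambda>\<theta>. u (cis \<theta> * z)))) \<le>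
    2 * \<Gamma> * (2 * pi + 4 * norm z) + G * (28 * norm z - 11 / 3 * pi * (norm z)\<^sup>2)"
    by (rule has_integral_le[OF 1 2]) (use Re_neumann_rotation_le[OF u G \<gamma> \<Gamma> z a] in auto)
qed

lemma has_wirtinger_laplacian_poisson_extension:
  assumes "continuous_on (sphere 0 1) \<phi>"
  shows "has_wirtinger_laplacian (\<lambda>z. if norm z < 1 then poisson_integral \<phi> z else \<phi> z) (\<lambda>_. 0) (ball 0 1)"
proof -
  obtain f k where fk: "f holomorphic_on ball 0 1" "k holomorphic_on ball 0 1"
    "\<And>z. norm z < 1 \<Longrightarrow> poisson_integral \<phi> z = f z + cnj (k z)"
    using poisson_integral_decomposition[OF assms] by blast
  have "has_wirtinger_laplacian (\<lambda>z. 1 * f z + 1 * cnj (k z)) (\<lambda>_. 1 * 0 + 1 * 0) (ball 0 1)"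
    by (intro has_wirtinger_laplacian_lincomb has_wirtinger_laplacian_holomorphic
        has_wirtinger_laplacian_cnj_holomorphic fk open_ball)
  then show ?thesis
    by (rule has_wirtinger_laplacian_cong) (auto simp: fk(3))
qed

text \<open>The harmonic function \<open>P\<close> with the boundary values of \<open>u\<close> has
  the same mean over every circle about 0, and \<open>u - P\<close> vanishes on the unit circle, so
  \<open>norm_le_dirichlet\<close> applies to it.\<close>

lemma norm_circle_mean_diff_le:
  assumes u: "continuous_on (cball 0 1) u" "has_wirtinger_laplacian u g (ball 0 1)"
    and G: "\<And>z. norm z < 1 \<Longrightarrow> norm (g z) \<le> G" and z: "norm z < 1"
  shows "norm (integral {0..2 * pi} (\<lambda>\<theta>. u (cis \<theta> * z)) - integral {0..2 * pi} (\<lambda>\<theta>. u (cis \<theta>)))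
    \<le> 2 * pi * (G * (1 - (norm z)\<^sup>2))"
proof -
  have uT: "continuous_on (sphere 0 1) u" by (rule continuous_on_subset[OF u(1)]) auto
  define P where "P = (\<lambda>z. if norm z < 1 then poisson_integral u z else u z)"
  have P: "continuous_on (cball 0 1) P" unfolding P_def by (rule continuous_on_poisson_extension[OF uT])
  obtain f k where fk: "f holomorphic_on ball 0 1" "k holomorphic_on ball 0 1"
    "\<And>z. norm z < 1 \<Longrightarrow> poisson_integral u z = f z + cnj (k z)"
    using poisson_integral_decomposition[OF uT] by blast
  \<comment> \<open>The functions \<open>f\<close> and \<open>k\<close> are known only in the open
    disc, so the mean value property is applied to $F(xz)$ as a function of $x$, continuous on the
    closed disc because $|z| < 1$.\<close>
  have dil: "((\<lambda>\<theta>. F (cis \<theta> * z)) has_integral 2 * of_real pi * F 0) {0..2 * pi}"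
    if F: "F holomorphic_on ball 0 1" for F
  proof -
    have m: "x * z \<in> ball 0 1" if "x \<in> cball 0 1" for x
      using that z mult_right_mono[of "norm x" 1 "norm z"] by (simp add: norm_mult)
    have "continuous_on (cball 0 1) (\<lambda>x. F (x * z))"
      by (rule continuous_on_compose2[OF holomorphic_on_imp_continuous_on[OF F]])
        (use m in \<open>auto intro!: continuous_intros\<close>)
    moreover have "(\<lambda>x. F (x * z)) holomorphic_on ball 0 1"
      using m by (intro holomorphic_on_compose_gen[OF _ F, unfolded o_def] holomorphic_intros) auto
    ultimately show ?thesis using has_integral_circle_mean[of "\<lambda>x. F (x * z)"] by simp
  qed
  have "((\<lambda>\<theta>. f (cis \<theta> * z) + cnj (k (cis \<theta> * z))) has_integral
      2 * of_real pi * f 0 + cnj (2 * of_real pi * k 0)) {0..2 * pi}"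
    using has_integral_cnj[THEN iffD2, OF dil[OF fk(2)]] by (intro has_integral_add dil fk) (simp add: o_def)
  moreover have "P (cis \<theta> * z) = f (cis \<theta> * z) + cnj (k (cis \<theta> * z))" for \<theta>
    using z fk(3) by (simp add: P_def norm_mult)
  ultimately have 1: "((\<lambda>\<theta>. P (cis \<theta> * z)) has_integral 2 * of_real pi * poisson_integral u 0) {0..2 * pi}"
    by (simp add: fk(3) algebra_simps)
  have "2 * of_real pi * poisson_integral u 0 = integral {0..2 * pi} (\<lambda>\<theta>. u (cis \<theta>))"
    by (simp add: poisson_integral_def)
  with 1 have 2: "((\<lambda>\<theta>. u (cis \<theta> * z) - P (cis \<theta> * z)) has_integral
    (integral {0..2 * pi} (\<lambda>\<theta>. u (cis \<theta> * z)) - integral {0..2 * pi} (\<lambda>\<theta>. u (cis \<theta>)))) {0..2 * pi}"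
    using z by (intro has_integral_diff integrable_integral circle_rotation_integrable u) auto
  have le: "norm (u \<zeta> - P \<zeta>) \<le> G * (1 - (norm \<zeta>)\<^sup>2)" if "norm \<zeta> \<le> 1" for \<zeta>
  proof -
    have lap: "has_wirtinger_laplacian (\<lambda>z. 1 * u z + (-1) * P z) (\<lambda>z. 1 * g z + (-1) * 0) (ball 0 1)"
      unfolding P_def by (intro has_wirtinger_laplacian_lincomb u(2) has_wirtinger_laplacian_poisson_extension uT)
    have "norm (1 * u \<zeta> + (-1) * P \<zeta>) \<le> G * (1 - (norm \<zeta>)\<^sup>2)"
    proof (rule norm_le_dirichlet[OF _ lap])
      show "continuous_on (cball 0 1) (\<lambda>z. 1 * u z + (-1) * P z)" by (intro continuous_intros u P)
    qed (use G that in \<open>auto simp: P_def\<close>)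
    then show ?thesis by simp
  qed
  have "norm (integral {0..2 * pi} (\<lambda>\<theta>. u (cis \<theta> * z)) - integral {0..2 * pi} (\<lambda>\<theta>. u (cis \<theta>)))
    \<le> G * (1 - (norm z)\<^sup>2) * measure lborel (cbox 0 (2 * pi))"
  proof (rule has_integral_bound)
    show "0 \<le> G * (1 - (norm z)\<^sup>2)" using le[of z] z norm_ge_zero order_trans by (metis less_imp_le)
    show "((\<lambda>\<theta>. u (cis \<theta> * z) - P (cis \<theta> * z)) has_integral
    (integral {0..2 * pi} (\<lambda>\<theta>. u (cis \<theta> * z)) - integral {0..2 * pi} (\<lambda>\<theta>. u (cis \<theta>)))) (cbox 0 (2 * pi))"
      using 2 by simp
    show "norm (u (cis \<theta> * z) - P (cis \<theta> * z)) \<le> G * (1 - (norm z)\<^sup>2)" for \<theta>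
      using le[of "cis \<theta> * z"] z by (simp add: norm_mult)
  qed
  then show ?thesis by (simp add: mult.commute)
qed

lemma neumann_solution_bound:
  assumes u: "continuous_on (cball 0 1) u" "has_wirtinger_laplacian u g (ball 0 1)"
    and G: "\<And>z. norm z < 1 \<Longrightarrow> norm (g z) \<le> G"
    and \<gamma>: "\<And>\<zeta>. norm \<zeta> = 1 \<Longrightarrow> has_outward_normal_derivative u (\<gamma> \<zeta>) \<zeta>"
    and \<Gamma>: "\<And>\<zeta>. norm \<zeta> = 1 \<Longrightarrow> norm (\<gamma> \<zeta>) \<le> \<Gamma>"
    and c: "integral {0..2 * pi} (\<lambda>\<theta>. u (cis \<theta>)) = 2 * of_real pi * c"
    and z: "norm z < 1"
  shows "norm (u z - c) \<le> 2 * \<Gamma> * (1 + 2 / pi) + 3 * G"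
proof -
  define t where "t = norm z"
  have t: "0 \<le> t" "t < 1" using z by (auto simp: t_def)
  have G0: "G \<ge> 0" using order_trans[OF norm_ge_zero G[of 0]] by simp
  have \<Gamma>0: "\<Gamma> \<ge> 0" using order_trans[OF norm_ge_zero \<Gamma>[of 1]] by simp
  have "2 * of_real pi * (u z - c) = (2 * of_real pi * u z - integral {0..2 * pi} (\<lambda>\<theta>. u (cis \<theta> * z)))
     + (integral {0..2 * pi} (\<lambda>\<theta>. u (cis \<theta> * z)) - integral {0..2 * pi} (\<lambda>\<theta>. u (cis \<theta>)))"
    by (simp add: c right_diff_distrib)
  also have "norm \<dots> \<le> (2 * \<Gamma> * (2 * pi + 4 * t) + G * (28 * t - 11 / 3 * pi * t\<^sup>2)) + 2 * pi * (G * (1 - t\<^sup>2))"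
    unfolding t_def using z
    by (intro order_trans[OF norm_triangle_ineq] add_mono norm_diff_circle_mean_le[OF u G \<gamma> \<Gamma>] norm_circle_mean_diff_le[OF u G]) auto
  also have "\<dots> = 2 * pi * (2 * \<Gamma> * (1 + 2 / pi * t) + G * (1 + 14 / pi * t - 17 / 6 * t\<^sup>2))"
    by (simp add: field_simps)
  finally have "2 * pi * norm (u z - c) \<le> 2 * pi * (2 * \<Gamma> * (1 + 2 / pi * t) + G * (1 + 14 / pi * t - 17 / 6 * t\<^sup>2))"
    by (simp add: norm_mult)
  then have "norm (u z - c) \<le> 2 * \<Gamma> * (1 + 2 / pi * t) + G * (1 + 14 / pi * t - 17 / 6 * t\<^sup>2)" by simp
  also have "\<dots> \<le> 2 * \<Gamma> * (1 + 2 / pi) + G * 3"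
  proof (intro add_mono mult_left_mono)
    show "2 / pi * t \<le> 2 / pi" using mult_left_mono[of t 1 "2 / pi"] t by simp
    have "14 / pi * t \<le> 14 / 3 * t" using pi_gt3 t by (intro mult_right_mono divide_left_mono) auto
    \<comment> \<open>The maximum of $(14/3)t - (17/6)t^2$ is $98/51 < 2$, attained at $t = 14/17$;
      the square encodes this.\<close>
    moreover have "0 \<le> (17 * t - 14)\<^sup>2" by simp
    then have "14 / 3 * t \<le> 2 + 17 / 6 * t\<^sup>2" by (simp add: power2_eq_square algebra_simps)
    ultimately show "1 + 14 / pi * t - 17 / 6 * t\<^sup>2 \<le> 3" by simp
  qed (use G0 \<Gamma>0 in auto)
  finally show ?thesis by simp
qed

text \<open>The terms of \<open>N3\<close> and \<open>N4\<close> that depend on $t$ are smallest at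
  $t = 0$, by $t^2 \<le> t$ and the comparison of the two roots. For \<open>N3\<close> it then
  remains to compare about 6.62 with about 6.55, which explains the accuracy of the
  decimals.\<close>

lemma N3_N4_lower_bounds:
  assumes t: "0 \<le> t" "t \<le> 1"
  shows "4 * (1 + 2 / pi) \<le> N3 t" "6 \<le> N4 t"
proof -
  have pi: "3.14 \<le> pi" using pi_approx by simp
  have "3.14\<^sup>2 \<le> pi\<^sup>2" using pi by (intro power_mono) auto
  then have pi2: "9.8596 \<le> pi\<^sup>2" by (simp add: power2_eq_square)
  have A: "207 / 100 \<le> sqrt (pi\<^sup>2 / 3 + 1)" by (rule real_le_rsqrt) (use pi2 in \<open>simp add: power2_eq_square\<close>)
  define C where "C = sqrt (pi\<^sup>2 / 6 - 1)"
  have C: "4 / 5 \<le> C" unfolding C_def by (rule real_le_rsqrt) (use pi2 in \<open>simp add: power2_eq_square\<close>)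
  have D: "83 / 50 \<le> sqrt (pi\<^sup>2 / 3 - 1 / 2)" by (rule real_le_rsqrt) (use pi2 in \<open>simp add: power2_eq_square\<close>)
  have B: "C \<le> sqrt (2 / 3 * pi\<^sup>2 - 2)" unfolding C_def by (rule real_sqrt_le_mono) (use pi2 in simp)
  have tt: "t\<^sup>2 \<le> t" using t by (simp add: power2_eq_square mult_left_le)
  have "t * C \<le> t * sqrt (2 / 3 * pi\<^sup>2 - 2)" using B t by (intro mult_left_mono) auto
  moreover have "t\<^sup>2 * C \<le> t * C" using tt C by (intro mult_right_mono) auto
  ultimately have BC: "C \<le> t * sqrt (2 / 3 * pi\<^sup>2 - 2) + (1 - t\<^sup>2) * C" by (simp add: algebra_simps)
  have "2 / pi \<le> 2 / 3.14" using pi by (intro divide_left_mono) auto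
  then show "4 * (1 + 2 / pi) \<le> N3 t"
    using A C D BC unfolding N3_def C_def[symmetric] by simp
  define x y where "x = t * sqrt (2 / 3 * pi\<^sup>2 - 2)" and "y = (1 - t\<^sup>2) * C"
  have "ln 4 = 2 * ln (2::real)" using ln_realpow[of "2::real" 2] by simp
  then have ln4: "4 / 3 \<le> ln (4::real)" using ln2_ge_two_thirds by simp
  have x: "0 \<le> x" unfolding x_def using B C t by (intro mult_nonneg_nonneg) linarith+
  have xy: "C \<le> x + y" using BC unfolding x_def y_def .
  have "N4 t = 2 * (ln 4 + 1) + x + 2 / 3 * y + 2 / 3 * sqrt (pi\<^sup>2 / 3 - 1 / 2)"
    by (simp add: N4_def C_def x_def y_def)
  moreover have "2 / 3 * (4 / 5) \<le> x + 2 / 3 * y" using x xy C by argo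
  moreover have "2 / 3 * (83 / 50) \<le> 2 / 3 * sqrt (pi\<^sup>2 / 3 - 1 / 2)" using D by (intro mult_left_mono) auto
  ultimately show "6 \<le> N4 t" using ln4 by argo
qed

text \<open>A real \<open>SUP\<close> is an upper bound only for a set that is bounded above, so
  each use has to supply some bound \<open>B\<close>.\<close>

lemma norm_le_sup_norm_on:
  assumes "\<And>z. z \<in> S \<Longrightarrow> norm (f z) \<le> B" "z \<in> S"
  shows "norm (f z) \<le> sup_norm_on S f"
  unfolding sup_norm_on_def by (rule cSUP_upper) (use assms in \<open>auto intro!: bdd_aboveI2[of _ _ B]\<close>)

lemma norm_le_sup_norm_on_compact:
  assumes "compact K" "continuous_on K f" "S \<subseteq> K" "z \<in> S"
  shows "norm (f z) \<le> sup_norm_on S f"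
proof -
  have "bounded (f ` K)" using assms by (intro compact_imp_bounded compact_continuous_image)
  then obtain B where "\<And>z. z \<in> K \<Longrightarrow> norm (f z) \<le> B" unfolding bounded_iff by blast
  then show ?thesis using assms(3,4) by (intro norm_le_sup_norm_on) auto
qed

lemma norm_derivative_le:
  assumes w: "continuous_on (cball 0 1) w" "has_wirtinger_laplacian w L (ball 0 1)"
    and M: "\<And>z. norm z < 1 \<Longrightarrow> norm (L z - c) \<le> M"
    and B: "\<And>z. norm z < 1 \<Longrightarrow> norm (poisson_integral w z) \<le> B"
    and z: "norm z < 1" and D: "(w has_derivative D) (at z)" and \<xi>: "norm \<xi> = 1"
  shows "norm (D \<xi>) \<le> 4 / pi * B * (1 / (1 - (norm z)\<^sup>2)) + 2 * norm c + 2 * M"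
proof -
  have wT: "continuous_on (sphere 0 1) w" by (rule continuous_on_subset[OF w(1)]) auto
  define P where "P = (\<lambda>z. if norm z < 1 then poisson_integral w z else w z)"
  have P: "continuous_on (cball 0 1) P" unfolding P_def by (rule continuous_on_poisson_extension[OF wT])
  obtain f k where fk: "f holomorphic_on ball 0 1" "k holomorphic_on ball 0 1"
    "\<And>z. norm z < 1 \<Longrightarrow> poisson_integral w z = f z + cnj (k z)"
    using poisson_integral_decomposition[OF wT] by blast
  let ?v = "\<lambda>z. 1 * (1 * w z + (-1) * P z) + 1 * ((- c) * (z * cnj z) + c * 1)"
  let ?L = "\<lambda>z. 1 * (1 * L z + (-1) * 0) + 1 * ((- c) * 1 + c * 0)"
  have lap: "has_wirtinger_laplacian ?v ?L (ball 0 1)" unfolding P_def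
    by (intro has_wirtinger_laplacian_lincomb w(2) has_wirtinger_laplacian_poisson_extension wT
        has_wirtinger_laplacian_norm_square has_wirtinger_laplacian_holomorphic) auto
  have DP: "(P has_derivative (\<lambda>h. deriv f z * h + cnj (deriv k z * h))) (at z)"
    by (rule has_derivative_transform_within_open[OF harmonic_has_derivative[OF fk(1,2) z], of "ball 0 1"])
      (use z fk(3) in \<open>auto simp: P_def\<close>)
  have Dz: "((\<lambda>z. z * cnj z) has_derivative (\<lambda>h. z * cnj h + h * cnj z)) (at z)"
    by (auto intro!: derivative_eq_intros)
  have "(?v has_derivative (\<lambda>h. 1 * (1 * D h + (-1) * (deriv f z * h + cnj (deriv k z * h)))
      + 1 * ((- c) * (z * cnj h + h * cnj z) + 0))) (at z)"
    by (intro has_derivative_add has_derivative_mult_right D DP Dz has_derivative_const)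
  moreover have "continuous_on (cball 0 1) ?v" by (intro continuous_intros w P)
  moreover have "?v \<zeta> = 0" if "norm \<zeta> = 1" for \<zeta>
    using that by (simp add: P_def complex_norm_square[symmetric])
  moreover have "norm (?L \<zeta>) \<le> M" if "norm \<zeta> < 1" for \<zeta> using M[OF that] by simp
  ultimately have "norm (1 * (1 * D \<xi> + (-1) * (deriv f z * \<xi> + cnj (deriv k z * \<xi>)))
      + 1 * ((- c) * (z * cnj \<xi> + \<xi> * cnj z) + 0)) \<le> 2 * M"
    by (intro norm_dirichlet_derivative_le[OF _ lap _ _ z _ \<xi>])
  then have 1: "norm (D \<xi> - (deriv f z * \<xi> + cnj (deriv k z * \<xi>)) - c * (z * cnj \<xi> + \<xi> * cnj z)) \<le> 2 * M"
    by (simp add: algebra_simps)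
  have "norm (deriv f z * \<xi> + cnj (deriv k z * \<xi>)) \<le> norm (deriv f z) + norm (deriv k z)"
    using norm_triangle_ineq[of "deriv f z * \<xi>" "cnj (deriv k z * \<xi>)"] \<xi> by (simp add: norm_mult)
  also have "\<dots> \<le> 4 / pi * B * (1 / (1 - (norm z)\<^sup>2))"
    by (rule harmonic_gradient_le[OF fk(1,2) _ z]) (use B fk(3) in auto)
  finally have 2: "norm (deriv f z * \<xi> + cnj (deriv k z * \<xi>)) \<le> 4 / pi * B * (1 / (1 - (norm z)\<^sup>2))" .
  have "norm (z * cnj \<xi> + \<xi> * cnj z) \<le> 2"
    using norm_triangle_ineq[of "z * cnj \<xi>" "\<xi> * cnj z"] \<xi> z by (simp add: norm_mult)
  from mult_left_mono[OF this norm_ge_zero[of c]]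
  have 3: "norm (c * (z * cnj \<xi> + \<xi> * cnj z)) \<le> 2 * norm c"
    by (simp only: norm_mult mult.commute[of 2])
  from norm_triangle_mono[OF norm_triangle_mono[OF 1 2] 3] show ?thesis by simp
qed

lemma poisson_integral_cong:
  assumes "\<And>\<zeta>. norm \<zeta> = 1 \<Longrightarrow> \<phi> \<zeta> = \<psi> \<zeta>"
  shows "poisson_integral \<phi> z = poisson_integral \<psi> z"
  unfolding poisson_integral_def by (simp add: assms)

theorem theorem2p2:
  fixes g \<gamma>\<^sub>0 \<gamma> w u :: "complex \<Rightarrow> complex" and c :: complex
  assumes g: "continuous_on (closure \<bbbD>) g"
    and \<gamma>\<^sub>0: "continuous_on \<bbbT> \<gamma>\<^sub>0"
    and \<gamma>: "continuous_on \<bbbT> \<gamma>"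
    and w_C4: "C_k_on 4 w \<bbbD>"
    and w_cont: "continuous_on (closure \<bbbD>) w"
    and pde: "\<forall>z\<in>\<bbbD>. d_z_zbar (d_z_zbar w) z = g z"
    and dirichlet: "\<forall>\<zeta>\<in>\<bbbT>. w \<zeta> = \<gamma>\<^sub>0 \<zeta>"
    and u: "continuous_extension_to_closed_disc (d_z_zbar w) u"
    and neumann: "\<forall>\<zeta>\<in>\<bbbT>. has_outward_normal_derivative u (\<gamma> \<zeta>) \<zeta>"
    and mean_u: "1 / (2 * of_real pi * \<i>) * contour_integral (circlepath 0 1) (\<lambda>\<zeta>. u \<zeta> / \<zeta>) = c"
    and compat: "1 / (2 * of_real pi) * integral {0..2 * pi} (\<lambda>t. \<gamma> (cis t)) = 2 * disc_integral g"
  shows "\<forall>z\<in>\<bbbD>. jacobian_norm w z \<le>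
      4 / pi * sup_norm_on \<bbbD> (poisson_integral \<gamma>\<^sub>0) * (1 / (1 - (norm z)\<^sup>2))
      + 2 * norm c + sup_norm_on \<bbbT> \<gamma> * N3 (norm z) + sup_norm_on \<bbbD> g * N4 (norm z)"
proof
  fix z assume "z \<in> \<bbbD>"
  then have z: "norm z < 1" by simp
  have cl: "closure \<bbbD> = cball 0 1" by simp
  have w4: "C_k_on (Suc (Suc (Suc (Suc 0)))) w \<bbbD>" using w_C4 by (simp add: eval_nat_numeral)
  then have "C_k_on 2 w \<bbbD>" by (simp only: numeral_2_eq_2 C_k_on_SucD)
  then have lap_w: "has_wirtinger_laplacian w (d_z_zbar w) \<bbbD>" by (intro C2_has_wirtinger_laplacian) auto
  have "C_k_on 2 (d_z_zbar w) \<bbbD>" unfolding d_z_zbar_def numeral_2_eq_2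
    by (intro C_k_on_wirtinger w4 open_ball)
  then have "has_wirtinger_laplacian (d_z_zbar w) (d_z_zbar (d_z_zbar w)) \<bbbD>"
    by (intro C2_has_wirtinger_laplacian) auto
  then have lap_u: "has_wirtinger_laplacian u g \<bbbD>"
    by (rule has_wirtinger_laplacian_cong) (use u pde in \<open>auto simp: continuous_extension_to_closed_disc_def\<close>)
  have u_cont: "continuous_on (cball 0 1) u" using u cl by (simp add: continuous_extension_to_closed_disc_def)
  define G where "G = sup_norm_on \<bbbD> g"
  define \<Gamma> where "\<Gamma> = sup_norm_on \<bbbT> \<gamma>"
  define B where "B = sup_norm_on \<bbbD> (poisson_integral \<gamma>\<^sub>0)"
  have G: "norm (g z) \<le> G" if "norm z < 1" for z
    unfolding G_def by (rule norm_le_sup_norm_on_compact[of "cball 0 1"]) (use g cl that in auto)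
  have \<Gamma>: "norm (\<gamma> z) \<le> \<Gamma>" if "norm z = 1" for z
    unfolding \<Gamma>_def by (rule norm_le_sup_norm_on_compact[of \<bbbT>]) (use \<gamma> that in auto)
  have B: "norm (poisson_integral \<gamma>\<^sub>0 z) \<le> B" if "norm z < 1" for z
    unfolding B_def
  proof (rule norm_le_sup_norm_on)
    show "norm (poisson_integral \<gamma>\<^sub>0 \<zeta>) \<le> sup_norm_on \<bbbT> \<gamma>\<^sub>0" if "\<zeta> \<in> \<bbbD>" for \<zeta>
      by (rule norm_poisson_integral_le[OF \<gamma>\<^sub>0])
        (use that norm_le_sup_norm_on_compact[OF compact_sphere \<gamma>\<^sub>0 subset_refl] in auto)
  qed (use that in auto)
  have Pw: "poisson_integral w = poisson_integral \<gamma>\<^sub>0"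
    using poisson_integral_cong[of w \<gamma>\<^sub>0] dirichlet by auto
  \<comment> \<open>On the unit circle $d\<zeta>/\<zeta> = i dt$, so the condition on the contour
    integral says that \<open>u\<close> has mean \<open>c\<close>.\<close>
  have mean: "integral {0..2 * pi} (\<lambda>\<theta>. u (cis \<theta>)) = 2 * of_real pi * c"
    using mean_u unfolding contour_integral_circle_div by (simp add: field_simps)
  have M: "norm (u z - c) \<le> 2 * \<Gamma> * (1 + 2 / pi) + 3 * G" if "norm z < 1" for z
    by (rule neumann_solution_bound[where \<gamma>=\<gamma>, OF u_cont lap_u G _ \<Gamma>]) (use neumann mean that in auto)
  have M': "norm (d_z_zbar w z - c) \<le> 2 * \<Gamma> * (1 + 2 / pi) + 3 * G" if "norm z < 1" for z
    using M[OF that] u that unfolding continuous_extension_to_closed_disc_def by simp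
  obtain D where "(w has_derivative D) (at z)"
    using w4 \<open>z \<in> \<bbbD>\<close> unfolding C_k_on.simps differentiable_def by blast
  then have "(w has_derivative frechet_derivative w (at z)) (at z)" using frechet_derivative_at by metis
  then have le: "norm (frechet_derivative w (at z) \<xi>) \<le>
      4 / pi * B * (1 / (1 - (norm z)\<^sup>2)) + 2 * norm c + 2 * (2 * \<Gamma> * (1 + 2 / pi) + 3 * G)" if "norm \<xi> = 1" for \<xi>
    using norm_derivative_le[OF _ lap_w M' _ z _ that, of B] w_cont cl B Pw by simp
  have "0 \<le> G" using order_trans[OF norm_ge_zero G[of 0]] by simp
  have "0 \<le> \<Gamma>" using order_trans[OF norm_ge_zero \<Gamma>[of 1]] by simp
  have "2 * (2 * \<Gamma> * (1 + 2 / pi) + 3 * G) = \<Gamma> * (4 * (1 + 2 / pi)) + G * 6" by (simp add: algebra_simps)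
  also have "\<dots> \<le> \<Gamma> * N3 (norm z) + G * N4 (norm z)"
    using N3_N4_lower_bounds[of "norm z"] z \<open>0 \<le> G\<close> \<open>0 \<le> \<Gamma>\<close> by (intro add_mono mult_left_mono) auto
  finally have N: "2 * (2 * \<Gamma> * (1 + 2 / pi) + 3 * G) \<le> \<Gamma> * N3 (norm z) + G * N4 (norm z)" .
  have "jacobian_norm w z \<le> 4 / pi * B * (1 / (1 - (norm z)\<^sup>2)) + 2 * norm c + \<Gamma> * N3 (norm z) + G * N4 (norm z)"
    unfolding jacobian_norm_def
  proof (rule cSUP_least)
    fix \<xi> :: complex assume "\<xi> \<in> \<bbbT>"
    then show "norm (frechet_derivative w (at z) \<xi>) \<le>
      4 / pi * B * (1 / (1 - (norm z)\<^sup>2)) + 2 * norm c + \<Gamma> * N3 (norm z) + G * N4 (norm z)"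
      using le[of \<xi>] N by simp
  qed (auto intro!: exI[of _ 1])
  then show "jacobian_norm w z \<le>
      4 / pi * sup_norm_on \<bbbD> (poisson_integral \<gamma>\<^sub>0) * (1 / (1 - (norm z)\<^sup>2))
      + 2 * norm c + sup_norm_on \<bbbT> \<gamma> * N3 (norm z) + sup_norm_on \<bbbD> g * N4 (norm z)"
    by (simp add: B_def G_def \<Gamma>_def)
qed

end
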